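(* Let $n\ge 1$ and let $A \subseteq \mathbb{R}^n$ be a nonempty compact set (with the Euclidean metric). Then $\overline{\dim}_{\mathrm{Mag}} A = \overline{\dim}_{\mathrm{Mink}} A$ and $\underline{\dim}_{\mathrm{Mag}} A = \underline{\dim}_{\mathrm{Mink}} A$. Consequently, $\dim_{\mathrm{Mag}} A$ is defined if and only if $\dim_{\mathrm{Mink}} A$ is defined, and in that case $\dim_{\mathrm{Mag}} A = \dim_{\mathrm{Mink}} A$.
   Context: Magnitude. For a metric space $(X,d)$ let $FM(X)$ be the space of finitely supported complex measures on $X$, and put $\langle \mu,\nu\rangle_{\mathcal W} := \int\int e^{-d(a,b)}\,d\mu(a)\,d\overline{\nu}(b)$. $X$ is positive definite if this form is a positive definite inner product on $FM(X)$; it is known that every $\mathbb{R}^n$ and all its subsets are positive definite. Let $\mathcal W$ be the Hilbert space completion of $FM(X)$, and for compact $A\subseteq X$ let $\mathcal W_A$ be the closure of $FM(A)$ in $\mathcal W$. For $w\in\mathcal W$ let $Zw(x):=\langle w,\delta_x\rangle_{\mathcal W}$, $x\in X$ (so $Z\mu(x)=\int e^{-d(x,y)}\,d\mu(y)$ for $\mu\in FM(X)$). A weighting for $A$ is an element $w\in\mathcal W_A$ with $Zw(a)=1$ for all $a\in A$; it is unique if it exists. The magnitude of $A$ is $|A|:=\|w\|_{\mathcal W}^2$ if a weighting $w$ exists, and $|A|:=\infty$ otherwise. This does not depend on the ambient space $X$. For $t>0$, $tA$ denotes $(A,td)$, which for $A\subseteq\mathbb{R}^n$ is isometric to $\{ta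 : a\in A\}$. Magnitude dimensions. $\overline{\dim}_{\mathrm{Mag}} A := \limsup_{t\to\infty}\frac{\log|tA|}{\log t}$ and $\underline{\dim}_{\mathrm{Mag}} A := \liminf_{t\to\infty}\frac{\log|tA|}{\log t}$; when these are equal, $\dim_{\mathrm{Mag}} A$ is defined to be the common value. Minkowski dimensions. For $\varepsilon>0$ let $N(A,\varepsilon)$ be the minimum number of closed $\varepsilon$-balls in $A$ needed to cover $A$. $\overline{\dim}_{\mathrm{Mink}} A := \limsup_{\varepsilon\to0^+}\frac{\log N(A,\varepsilon)}{\log(1/\varepsilon)}$ and $\underline{\dim}_{\mathrm{Mink}} A := \liminf_{\varepsilon\to0^+}\frac{\log N(A,\varepsilon)}{\log(1/\varepsilon)}$; when these are equal, $\dim_{\mathrm{Mink}} A$ is defined to be the common value. *)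

theory Defs
  imports "HOL-Analysis.Analysis" "HOL-Library.Poly_Mapping"
begin

section \<open>Magnitude of compact sets\<close>

text \<open>
  A metric space is given by a carrier \<open>X\<close> and a distance function \<open>d\<close>, so that rescaling the
  metric is just a change of \<open>d\<close>. All notions below are meant for positive definite \<open>(X, d)\<close>, i.e.
  for spaces on which \<open>W_form d\<close> is a positive definite inner product on \<open>FM X\<close>; every subset of
  a Euclidean space, with any positive multiple of the Euclidean metric, is known to be one.

  A finitely supported complex measure is represented by its point masses, as a finitely supported
  function.
\<close>

definition FM :: "'a set \<Rightarrow> ('a \<Rightarrow>\<^sub>0 complex) set" where
  "FM X = {\<mu>. Poly_Mapping.keys \<mu> \<subseteq> X}"

abbreviation point_mass :: "'a \<Rightarrow> ('a \<Rightarrow>\<^sub>0 complex)" where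
  "point_mass x \<equiv> Poly_Mapping.single x 1"

definition W_form :: "('a \<Rightarrow> 'a \<Rightarrow> real) \<Rightarrow> ('a \<Rightarrow>\<^sub>0 complex) \<Rightarrow> ('a \<Rightarrow>\<^sub>0 complex) \<Rightarrow> complex" where
  "W_form d \<mu> \<nu> = (\<Sum>a\<in>Poly_Mapping.keys \<mu>. \<Sum>b\<in>Poly_Mapping.keys \<nu>.
      of_real (exp (- d a b)) * Poly_Mapping.lookup \<mu> a * cnj (Poly_Mapping.lookup \<nu> b))"

definition FM_norm :: "('a \<Rightarrow> 'a \<Rightarrow> real) \<Rightarrow> ('a \<Rightarrow>\<^sub>0 complex) \<Rightarrow> real" where
  "FM_norm d \<mu> = sqrt (Re (W_form d \<mu> \<mu>))"

text \<open>
  The Hilbert space completion \<open>W_space X d\<close> of \<open>FM X\<close> is the set of Cauchy sequences in \<open>FM X\<close>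
  modulo sequences that tend to zero in norm. Its elements are equivalence classes, and the
  operations on it are induced by arbitrary representatives.
\<close>

definition FM_Cauchy :: "'a set \<Rightarrow> ('a \<Rightarrow> 'a \<Rightarrow> real) \<Rightarrow> (nat \<Rightarrow> 'a \<Rightarrow>\<^sub>0 complex) set" where
  "FM_Cauchy X d = {f. (\<forall>n. f n \<in> FM X) \<and>
      (\<forall>e>0. \<exists>M. \<forall>m\<ge>M. \<forall>n\<ge>M. FM_norm d (f m - f n) < e)}"

definition W_rel :: "'a set \<Rightarrow> ('a \<Rightarrow> 'a \<Rightarrow> real) \<Rightarrow>
    ((nat \<Rightarrow> 'a \<Rightarrow>\<^sub>0 complex) \<times> (nat \<Rightarrow> 'a \<Rightarrow>\<^sub>0 complex)) set" where
  "W_rel X d = {(f, g). f \<in> FM_Cauchy X d \<and> g \<in> FM_Cauchy X d \<and>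
      (\<lambda>n. FM_norm d (f n - g n)) \<longlonglongrightarrow> 0}"

definition W_space :: "'a set \<Rightarrow> ('a \<Rightarrow> 'a \<Rightarrow> real) \<Rightarrow> (nat \<Rightarrow> 'a \<Rightarrow>\<^sub>0 complex) set set" where
  "W_space X d = FM_Cauchy X d // W_rel X d"

definition W_embed :: "'a set \<Rightarrow> ('a \<Rightarrow> 'a \<Rightarrow> real) \<Rightarrow> ('a \<Rightarrow>\<^sub>0 complex) \<Rightarrow>
    (nat \<Rightarrow> 'a \<Rightarrow>\<^sub>0 complex) set" where
  "W_embed X d \<mu> = W_rel X d `` {\<lambda>_. \<mu>}"

definition W_inner :: "('a \<Rightarrow> 'a \<Rightarrow> real) \<Rightarrow> (nat \<Rightarrow> 'a \<Rightarrow>\<^sub>0 complex) set \<Rightarrow>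
    (nat \<Rightarrow> 'a \<Rightarrow>\<^sub>0 complex) set \<Rightarrow> complex" where
  "W_inner d u v = (THE z. \<forall>f\<in>u. \<forall>g\<in>v. (\<lambda>n. W_form d (f n) (g n)) \<longlonglongrightarrow> z)"

definition W_norm :: "('a \<Rightarrow> 'a \<Rightarrow> real) \<Rightarrow> (nat \<Rightarrow> 'a \<Rightarrow>\<^sub>0 complex) set \<Rightarrow> real" where
  "W_norm d u = sqrt (Re (W_inner d u u))"

definition W_minus :: "'a set \<Rightarrow> ('a \<Rightarrow> 'a \<Rightarrow> real) \<Rightarrow> (nat \<Rightarrow> 'a \<Rightarrow>\<^sub>0 complex) set \<Rightarrow>
    (nat \<Rightarrow> 'a \<Rightarrow>\<^sub>0 complex) set \<Rightarrow> (nat \<Rightarrow> 'a \<Rightarrow>\<^sub>0 complex) set" where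
  "W_minus X d u v = (\<Union>f\<in>u. \<Union>g\<in>v. W_rel X d `` {\<lambda>n. f n - g n})"

text \<open>The closure of \<open>FM A\<close> in \<open>W_space X d\<close>.\<close>

definition W_sub :: "'a set \<Rightarrow> ('a \<Rightarrow> 'a \<Rightarrow> real) \<Rightarrow> 'a set \<Rightarrow> (nat \<Rightarrow> 'a \<Rightarrow>\<^sub>0 complex) set set" where
  "W_sub X d A = {w \<in> W_space X d.
      \<forall>e>0. \<exists>\<mu>\<in>FM A. W_norm d (W_minus X d w (W_embed X d \<mu>)) < e}"

definition Z_op :: "'a set \<Rightarrow> ('a \<Rightarrow> 'a \<Rightarrow> real) \<Rightarrow> (nat \<Rightarrow> 'a \<Rightarrow>\<^sub>0 complex) set \<Rightarrow> 'a \<Rightarrow> complex" where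
  "Z_op X d w x = W_inner d w (W_embed X d (point_mass x))"

definition is_weighting :: "'a set \<Rightarrow> ('a \<Rightarrow> 'a \<Rightarrow> real) \<Rightarrow> 'a set \<Rightarrow>
    (nat \<Rightarrow> 'a \<Rightarrow>\<^sub>0 complex) set \<Rightarrow> bool" where
  "is_weighting X d A w \<longleftrightarrow> w \<in> W_sub X d A \<and> (\<forall>a\<in>A. Z_op X d w a = 1)"

definition magnitude :: "'a set \<Rightarrow> ('a \<Rightarrow> 'a \<Rightarrow> real) \<Rightarrow> 'a set \<Rightarrow> ereal" where
  "magnitude X d A =
     (if \<exists>w. is_weighting X d A w
      then ereal ((W_norm d (THE w. is_weighting X d A w))\<^sup>2) else \<infinity>)"

text \<open>The magnitude of \<open>tA = (A, t d)\<close>, with the whole type, likewise rescaled, as ambient space.\<close>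

definition scaled_magnitude :: "real \<Rightarrow> 'a::metric_space set \<Rightarrow> ereal" where
  "scaled_magnitude t A = magnitude UNIV (\<lambda>x y. t * dist x y) A"


section \<open>Magnitude dimensions\<close>

definition ereal_ln :: "ereal \<Rightarrow> ereal" where
  "ereal_ln x = (if x \<le> 0 then - \<infinity> else if x = \<infinity> then \<infinity> else ereal (ln (real_of_ereal x)))"

definition upper_Mag_dim :: "'a::metric_space set \<Rightarrow> ereal" where
  "upper_Mag_dim A = Limsup at_top (\<lambda>t::real. ereal_ln (scaled_magnitude t A) / ereal (ln t))"

definition lower_Mag_dim :: "'a::metric_space set \<Rightarrow> ereal" where
  "lower_Mag_dim A = Liminf at_top (\<lambda>t::real. ereal_ln (scaled_magnitude t A) / ereal (ln t))"

definition Mag_dim_defined :: "'a::metric_space set \<Rightarrow> bool" where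
  "Mag_dim_defined A \<longleftrightarrow> upper_Mag_dim A = lower_Mag_dim A"

definition Mag_dim :: "'a::metric_space set \<Rightarrow> ereal" where
  "Mag_dim A = (THE s. upper_Mag_dim A = s \<and> lower_Mag_dim A = s)"


section \<open>Minkowski dimensions\<close>

text \<open>
  The balls are those of the metric space \<open>A\<close>, so their centres lie in \<open>A\<close>. The minimum exists
  for totally bounded \<open>A\<close>, in particular for compact \<open>A\<close>.
\<close>

definition covering_number :: "'a::metric_space set \<Rightarrow> real \<Rightarrow> nat" where
  "covering_number A \<epsilon> = (LEAST k. \<exists>S. finite S \<and> S \<subseteq> A \<and> card S = k \<and>
      A \<subseteq> (\<Union>x\<in>S. cball x \<epsilon>))"

definition upper_Mink_dim :: "'a::metric_space set \<Rightarrow> ereal" where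
  "upper_Mink_dim A =
     Limsup (at_right 0) (\<lambda>\<epsilon>::real. ereal (ln (real (covering_number A \<epsilon>)) / ln (1 / \<epsilon>)))"

definition lower_Mink_dim :: "'a::metric_space set \<Rightarrow> ereal" where
  "lower_Mink_dim A =
     Liminf (at_right 0) (\<lambda>\<epsilon>::real. ereal (ln (real (covering_number A \<epsilon>)) / ln (1 / \<epsilon>)))"

definition Mink_dim_defined :: "'a::metric_space set \<Rightarrow> bool" where
  "Mink_dim_defined A \<longleftrightarrow> upper_Mink_dim A = lower_Mink_dim A"

definition Mink_dim :: "'a::metric_space set \<Rightarrow> ereal" where
  "Mink_dim A = (THE s. upper_Mink_dim A = s \<and> lower_Mink_dim A = s)"

end

theory Submission
  imports Defs "HOL-Probability.Probability" "HOL-Real_Asymp.Real_Asymp"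
begin

text \<open>
  For compact \<open>A\<close> in a Euclidean space of dimension \<open>n\<close> and every \<open>t > 0\<close> the magnitude \<open>|tA|\<close> agrees
  with the covering number \<open>N(A, 1/t)\<close> up to factors that depend on \<open>n\<close> only
  (\<open>scaled_magnitude_comparison\<close>). Taking logarithms and dividing by \<open>ln t\<close> makes these factors
  disappear in the limit, whence both pairs of dimensions agree.

  The comparison rests on the variational description of magnitude (\<open>magnitude_variational\<close>):
  \<open>|A|\<close> is the least \<open>m\<close> such that \<open>|\<mu>(A)|\<^sup>2 \<le> m \<parallel>\<mu>\<parallel>\<^sup>2\<close> for all finitely supported \<open>\<mu>\<close> on \<open>A\<close>, and it is
  finite as soon as such an \<open>m\<close> exists. This is the Riesz representation theorem for the functional
  \<open>\<mu> \<mapsto> \<mu>(A)\<close>.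

  Lower bound: test with the counting measure of a maximal \<open>1/t\<close>-separated subset \<open>S\<close> of \<open>A\<close>. By comparing
  volumes, \<open>\<Sum>b\<in>S. exp (- t |a - b|)\<close> is bounded by a constant of \<open>n\<close> for every \<open>a\<close>
  (\<open>separated_exp_sum_le\<close>), so that \<open>|tA|\<close> is at least a constant times \<open>card S\<close>.

  Upper bound: \<open>exp (- t |x - y|)\<close> is the probability that \<open>x\<close> and \<open>y\<close> lie in the same cell of a random
  tessellation of space by hyperplanes. Hence \<open>\<parallel>\<mu>\<parallel>\<^sup>2\<close> is the expectation of the sum of \<open>|\<mu>(C)|\<^sup>2\<close> over
  the cells \<open>C\<close>. In particular it is nonnegative, and by the Cauchy-Schwarz inequality it is at least
  \<open>|\<mu>(A)|\<^sup>2\<close> divided by the expected number of cells that \<open>A\<close> meets. A ball of radius \<open>1/t\<close> meets boundedly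
  many cells on average, so this number is at most a constant times \<open>N(A, 1/t)\<close>.

  As only finitely many points matter at a time, no point process is required. Restricted to a finite
  set \<open>F\<close>, every metric of the form \<open>\<integral>|f\<^sub>a - f\<^sub>b|\<close> is a nonnegative combination of the cut metrics of the subsets
  of \<open>F\<close> (\<open>L1_metric_cut_decomposition\<close>), and the tessellation becomes an independent choice of cuts
  (\<open>cut_metric_form\<close>). The Euclidean metric has this form because the projection of a standard Gaussian
  vector to the direction of \<open>x\<close> has mean absolute value proportional to \<open>|x|\<close>.
\<close>

section \<open>The Hermitian form on finitely supported measures\<close>

lemma W_form_superset:
  assumes "finite U" "Poly_Mapping.keys \<mu> \<subseteq> U" "Poly_Mapping.keys \<nu> \<subseteq> U"
  shows "W_form d \<mu> \<nu> = (\<Sum>a\<in>U. \<Sum>b\<in>U.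
      of_real (exp (- d a b)) * Poly_Mapping.lookup \<mu> a * cnj (Poly_Mapping.lookup \<nu> b))"
proof -
  have "W_form d \<mu> \<nu> = (\<Sum>a\<in>Poly_Mapping.keys \<mu>. \<Sum>b\<in>U.
      of_real (exp (- d a b)) * Poly_Mapping.lookup \<mu> a * cnj (Poly_Mapping.lookup \<nu> b))"
    unfolding W_form_def
    by (intro sum.cong refl sum.mono_neutral_left assms) (simp add: in_keys_iff)
  also have "\<dots> = (\<Sum>a\<in>U. \<Sum>b\<in>U.
      of_real (exp (- d a b)) * Poly_Mapping.lookup \<mu> a * cnj (Poly_Mapping.lookup \<nu> b))"
    by (intro sum.mono_neutral_left assms) (simp add: in_keys_iff)
  finally show ?thesis .
qed

definition scale_FM :: "complex \<Rightarrow> ('a \<Rightarrow>\<^sub>0 complex) \<Rightarrow> ('a \<Rightarrow>\<^sub>0 complex)" where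
  "scale_FM c \<mu> = Poly_Mapping.map (\<lambda>z. c * z) \<mu>"

lemma lookup_scale_FM: "Poly_Mapping.lookup (scale_FM c \<mu>) x = c * Poly_Mapping.lookup \<mu> x"
  by (simp add: scale_FM_def Poly_Mapping.map.rep_eq when_def)

lemma keys_scale_FM: "Poly_Mapping.keys (scale_FM c \<mu>) \<subseteq> Poly_Mapping.keys \<mu>"
  by (auto simp: in_keys_iff lookup_scale_FM)

lemma W_form_add_left: "W_form d (\<mu> + \<mu>') \<nu> = W_form d \<mu> \<nu> + W_form d \<mu>' \<nu>"
proof -
  let ?U = "Poly_Mapping.keys \<mu> \<union> Poly_Mapping.keys \<mu>' \<union> Poly_Mapping.keys \<nu>"
  have *: "finite ?U" "Poly_Mapping.keys (\<mu> + \<mu>') \<subseteq> ?U"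
    using Poly_Mapping.keys_add[of \<mu> \<mu>'] by auto
  show ?thesis
    by (subst (1 2 3) W_form_superset[of ?U])
       (use * in \<open>auto simp: lookup_add algebra_simps sum.distrib\<close>)
qed

lemma W_form_scale_left: "W_form d (scale_FM c \<mu>) \<nu> = c * W_form d \<mu> \<nu>"
proof -
  let ?U = "Poly_Mapping.keys \<mu> \<union> Poly_Mapping.keys \<nu>"
  have *: "finite ?U" "Poly_Mapping.keys (scale_FM c \<mu>) \<subseteq> ?U"
    using keys_scale_FM[of c \<mu>] by auto
  show ?thesis
    by (subst (1 2) W_form_superset[of ?U])
       (use * in \<open>auto simp: lookup_scale_FM sum_distrib_left algebra_simps\<close>)
qed

lemma diff_FM_conv_scale: "\<mu> - \<nu> = \<mu> + scale_FM (-1) \<nu>" for \<mu> \<nu> :: "'a \<Rightarrow>\<^sub>0 complex"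
  by (rule poly_mapping_eqI) (simp add: lookup_add lookup_minus lookup_scale_FM)

lemma W_form_diff_left: "W_form d (\<mu> - \<mu>') \<nu> = W_form d \<mu> \<nu> - W_form d \<mu>' \<nu>"
  by (simp add: diff_FM_conv_scale W_form_add_left W_form_scale_left)

lemma W_form_zero_left [simp]: "W_form d 0 \<nu> = 0"
  by (simp add: W_form_def)

lemma FM_scale: "\<mu> \<in> FM X \<Longrightarrow> scale_FM c \<mu> \<in> FM X"
  using keys_scale_FM[of c \<mu>] by (auto simp: FM_def)

lemma FM_add: "\<mu> \<in> FM X \<Longrightarrow> \<nu> \<in> FM X \<Longrightarrow> \<mu> + \<nu> \<in> FM X"
  using Poly_Mapping.keys_add[of \<mu> \<nu>] by (auto simp: FM_def)

lemma FM_diff: "\<mu> \<in> FM X \<Longrightarrow> \<nu> \<in> FM X \<Longrightarrow> \<mu> - \<nu> \<in> FM X" for \<mu> \<nu> :: "'a \<Rightarrow>\<^sub>0 complex"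
  by (simp add: diff_FM_conv_scale FM_add FM_scale)

lemma FM_mono: "X \<subseteq> Y \<Longrightarrow> FM X \<subseteq> FM Y"
  by (auto simp: FM_def)

lemma point_mass_FM: "x \<in> X \<Longrightarrow> (point_mass x) \<in> FM X"
  by (simp add: FM_def)

definition total_mass :: "('a \<Rightarrow>\<^sub>0 complex) \<Rightarrow> complex" where
  "total_mass \<mu> = (\<Sum>a\<in>Poly_Mapping.keys \<mu>. Poly_Mapping.lookup \<mu> a)"

lemma total_mass_superset:
  assumes "finite U" "Poly_Mapping.keys \<mu> \<subseteq> U"
  shows "total_mass \<mu> = (\<Sum>a\<in>U. Poly_Mapping.lookup \<mu> a)"
  unfolding total_mass_def by (intro sum.mono_neutral_left assms) (simp add: in_keys_iff)

lemma total_mass_add: "total_mass (\<mu> + \<nu>) = total_mass \<mu> + total_mass \<nu>"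
proof -
  let ?U = "Poly_Mapping.keys \<mu> \<union> Poly_Mapping.keys \<nu>"
  have *: "finite ?U" "Poly_Mapping.keys (\<mu> + \<nu>) \<subseteq> ?U"
    using Poly_Mapping.keys_add[of \<mu> \<nu>] by auto
  show ?thesis
    by (subst (1 2 3) total_mass_superset[of ?U]) (use * in \<open>auto simp: lookup_add sum.distrib\<close>)
qed

lemma total_mass_scale: "total_mass (scale_FM c \<mu>) = c * total_mass \<mu>"
  by (subst total_mass_superset[of "Poly_Mapping.keys \<mu>"])
     (auto simp: lookup_scale_FM sum_distrib_left total_mass_def keys_scale_FM[THEN subsetD])

lemma total_mass_point_mass [simp]: "total_mass (point_mass x) = 1"
  by (simp add: total_mass_def)

lemma W_form_eq_sum_point_mass:
  "W_form d \<mu> \<nu> = (\<Sum>b\<in>Poly_Mapping.keys \<nu>. W_form d \<mu> (point_mass b) * cnj (Poly_Mapping.lookup \<nu> b))"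
  unfolding W_form_def by (subst sum.swap) (simp add: sum_distrib_right)

text \<open>
  Null vectors are allowed: elements of the completion are Cauchy sequences modulo null sequences, so
  null vectors become zero there, and a positive semidefinite form yields a Hilbert space.
\<close>

locale psd_kernel =
  fixes d :: "'a \<Rightarrow> 'a \<Rightarrow> real"
  assumes sym: "d a b = d b a"
    and psd: "0 \<le> Re (W_form d \<mu> \<mu>)"
begin

lemma form_cnj: "cnj (W_form d \<mu> \<nu>) = W_form d \<nu> \<mu>"
  unfolding W_form_def by (subst sum.swap) (simp add: sym mult_ac cong: sum.cong)

lemma form_self: "W_form d \<mu> \<mu> = complex_of_real ((FM_norm d \<mu>)\<^sup>2)"
proof -
  have "Im (W_form d \<mu> \<mu>) = 0"
    using form_cnj[of \<mu> \<mu>] by (metis cnj.sel(2) neg_equal_zero)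
  then show ?thesis
    by (simp add: FM_norm_def psd complex_eq_iff)
qed

lemma form_add_right: "W_form d \<mu> (\<nu> + \<nu>') = W_form d \<mu> \<nu> + W_form d \<mu> \<nu>'"
  by (metis W_form_add_left complex_cnj_add form_cnj)

lemma form_scale_right: "W_form d \<mu> (scale_FM c \<nu>) = cnj c * W_form d \<mu> \<nu>"
  by (metis W_form_scale_left complex_cnj_mult form_cnj)

lemma form_diff_right: "W_form d \<mu> (\<nu> - \<nu>') = W_form d \<mu> \<nu> - W_form d \<mu> \<nu>'"
  by (metis W_form_diff_left complex_cnj_diff form_cnj)

lemma seminorm_nonneg [simp]: "0 \<le> FM_norm d \<mu>"
  by (simp add: FM_norm_def psd)

lemma seminorm_sq: "(FM_norm d \<mu>)\<^sup>2 = Re (W_form d \<mu> \<mu>)"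
  by (simp add: FM_norm_def psd)

lemma seminorm_add_sq:
  "(FM_norm d (\<mu> + \<nu>))\<^sup>2 = (FM_norm d \<mu>)\<^sup>2 + 2 * Re (W_form d \<mu> \<nu>) + (FM_norm d \<nu>)\<^sup>2"
proof -
  have "Re (W_form d \<nu> \<mu>) = Re (W_form d \<mu> \<nu>)"
    by (metis cnj.sel(1) form_cnj)
  then show ?thesis
    by (simp add: seminorm_sq W_form_add_left form_add_right)
qed

lemma seminorm_scale: "FM_norm d (scale_FM c \<mu>) = cmod c * FM_norm d \<mu>"
proof -
  have "W_form d (scale_FM c \<mu>) (scale_FM c \<mu>) = complex_of_real ((cmod c * FM_norm d \<mu>)\<^sup>2)"
    by (simp add: W_form_scale_left form_scale_right form_self power_mult_distrib
        flip: complex_norm_square)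
  then have "(FM_norm d (scale_FM c \<mu>))\<^sup>2 = (cmod c * FM_norm d \<mu>)\<^sup>2"
    by (simp add: seminorm_sq)
  then show ?thesis
    by (simp add: power2_eq_iff_nonneg)
qed

text \<open>
  The squared seminorm of \<open>\<mu> + s z \<nu>\<close> with \<open>z = \<langle>\<mu>, \<nu>\<rangle>\<close> is a nonnegative quadratic polynomial in the real
  variable \<open>s\<close>. The case of a null vector \<open>\<nu>\<close> is separate, since the form may be degenerate.
\<close>

lemma cauchy_schwarz_sq: "(cmod (W_form d \<mu> \<nu>))\<^sup>2 \<le> (FM_norm d \<mu>)\<^sup>2 * (FM_norm d \<nu>)\<^sup>2"
proof -
  define z where "z = W_form d \<mu> \<nu>"
  have quad: "0 \<le> (FM_norm d \<mu>)\<^sup>2 + 2 * s * (cmod z)\<^sup>2 + s\<^sup>2 * (cmod z)\<^sup>2 * (FM_norm d \<nu>)\<^sup>2" for s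
  proof -
    have "0 \<le> (FM_norm d (\<mu> + scale_FM (of_real s * z) \<nu>))\<^sup>2"
      by simp
    also have "W_form d \<mu> (scale_FM (of_real s * z) \<nu>) = of_real (s * (cmod z)\<^sup>2)"
      using complex_norm_square[of z]
      by (simp add: form_scale_right flip: z_def)
    then have "(FM_norm d (\<mu> + scale_FM (of_real s * z) \<nu>))\<^sup>2 =
        (FM_norm d \<mu>)\<^sup>2 + 2 * s * (cmod z)\<^sup>2 + s\<^sup>2 * (cmod z)\<^sup>2 * (FM_norm d \<nu>)\<^sup>2"
      by (simp add: seminorm_add_sq seminorm_scale power_mult_distrib norm_mult)
    finally show ?thesis .
  qed
  show ?thesis
  proof (cases "FM_norm d \<nu> = 0")
    case True
    have "cmod z = 0"
    proof (rule ccontr)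
      assume nz: "cmod z \<noteq> 0"
      show False
        using quad[of "- ((FM_norm d \<mu>)\<^sup>2 + 1) / (2 * (cmod z)\<^sup>2)"] True nz
        by (simp add: field_simps)
    qed
    then show ?thesis
      by (simp add: z_def)
  next
    case False
    then have pos: "0 < (FM_norm d \<nu>)\<^sup>2"
      by simp
    have "(FM_norm d \<mu>)\<^sup>2 + 2 * s * (cmod z)\<^sup>2 + s\<^sup>2 * (cmod z)\<^sup>2 * (FM_norm d \<nu>)\<^sup>2 =
        (FM_norm d \<mu>)\<^sup>2 - (cmod z)\<^sup>2 / (FM_norm d \<nu>)\<^sup>2" if "s = - 1 / (FM_norm d \<nu>)\<^sup>2" for s
      using False by (simp add: that field_simps power2_eq_square)
    with quad have "(cmod z)\<^sup>2 / (FM_norm d \<nu>)\<^sup>2 \<le> (FM_norm d \<mu>)\<^sup>2"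
      by (metis diff_ge_0_iff_ge)
    then show ?thesis
      using pos by (simp add: pos_divide_le_eq z_def)
  qed
qed

lemma cauchy_schwarz: "cmod (W_form d \<mu> \<nu>) \<le> FM_norm d \<mu> * FM_norm d \<nu>"
  using cauchy_schwarz_sq[of \<mu> \<nu>] by (metis abs_le_square_iff abs_norm_cancel abs_of_nonneg
      mult_nonneg_nonneg seminorm_nonneg power_mult_distrib)

lemma seminorm_triangle: "FM_norm d (\<mu> + \<nu>) \<le> FM_norm d \<mu> + FM_norm d \<nu>"
proof -
  have "Re (W_form d \<mu> \<nu>) \<le> FM_norm d \<mu> * FM_norm d \<nu>"
    using cauchy_schwarz[of \<mu> \<nu>] complex_Re_le_cmod order_trans by blast
  then have "(FM_norm d (\<mu> + \<nu>))\<^sup>2 \<le> (FM_norm d \<mu> + FM_norm d \<nu>)\<^sup>2"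
    unfolding seminorm_add_sq by (simp add: power2_sum)
  then show ?thesis
    by (rule power2_le_imp_le) simp
qed

lemma seminorm_minus_commute: "FM_norm d (\<mu> - \<nu>) = FM_norm d (\<nu> - \<mu>)"
proof -
  have "\<mu> - \<nu> = scale_FM (-1) (\<nu> - \<mu>)"
    by (rule poly_mapping_eqI) (simp add: lookup_minus lookup_scale_FM)
  then show ?thesis
    by (simp add: seminorm_scale)
qed

lemma seminorm_triangle_diff: "FM_norm d (\<mu> - \<rho>) \<le> FM_norm d (\<mu> - \<nu>) + FM_norm d (\<nu> - \<rho>)"
  using seminorm_triangle[of "\<mu> - \<nu>" "\<nu> - \<rho>"] by simp

lemma seminorm_diff_diff_le:
  "FM_norm d ((\<mu> - \<nu>) - (\<mu>' - \<nu>')) \<le> FM_norm d (\<mu> - \<mu>') + FM_norm d (\<nu> - \<nu>')"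
proof -
  have "(\<mu> - \<nu>) - (\<mu>' - \<nu>') = (\<mu> - \<mu>') + (\<nu>' - \<nu>)"
    by (simp add: algebra_simps)
  then show ?thesis
    using seminorm_triangle[of "\<mu> - \<mu>'" "\<nu>' - \<nu>"] seminorm_minus_commute[of \<nu> \<nu>'] by metis
qed

lemma seminorm_zero [simp]: "FM_norm d 0 = 0"
  by (simp add: FM_norm_def)

lemma seminorm_diff_sq:
  "(FM_norm d (\<mu> - \<nu>))\<^sup>2 = (FM_norm d \<mu>)\<^sup>2 - 2 * Re (W_form d \<mu> \<nu>) + (FM_norm d \<nu>)\<^sup>2"
proof -
  have "Re (W_form d \<nu> \<mu>) = Re (W_form d \<mu> \<nu>)"
    by (metis cnj.sel(1) form_cnj)
  then show ?thesis
    by (simp add: seminorm_sq W_form_diff_left form_diff_right)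
qed

section \<open>The Hilbert space completion and its weightings\<close>

lemma FM_CauchyD:
  assumes "f \<in> FM_Cauchy X d" "e > 0"
  obtains M where "\<And>m n. m \<ge> M \<Longrightarrow> n \<ge> M \<Longrightarrow> FM_norm d (f m - f n) < e"
  using assms unfolding FM_Cauchy_def by blast

lemma seminorm_diff_ge: "\<bar>FM_norm d \<mu> - FM_norm d \<nu>\<bar> \<le> FM_norm d (\<mu> - \<nu>)"
  using seminorm_triangle[of "\<mu> - \<nu>" \<nu>] seminorm_triangle[of "\<nu> - \<mu>" \<mu>] seminorm_minus_commute[of \<mu> \<nu>]
  by simp

lemma seminorm_convergent:
  assumes "f \<in> FM_Cauchy X d"
  shows "convergent (\<lambda>n. FM_norm d (f n))"
proof (rule real_Cauchy_convergent, rule metric_CauchyI)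
  fix e :: real assume "e > 0"
  then obtain M where M: "\<And>m n. m \<ge> M \<Longrightarrow> n \<ge> M \<Longrightarrow> FM_norm d (f m - f n) < e"
    using FM_CauchyD[OF assms] by blast
  then show "\<exists>M. \<forall>m\<ge>M. \<forall>n\<ge>M. dist (FM_norm d (f m)) (FM_norm d (f n)) < e"
    unfolding dist_real_def by (meson seminorm_diff_ge order_le_less_trans)
qed

lemma seminorm_bounded:
  assumes "f \<in> FM_Cauchy X d"
  obtains K where "K > 0" "\<And>n. FM_norm d (f n) \<le> K"
proof -
  have "Bseq (\<lambda>n. FM_norm d (f n))"
    using seminorm_convergent[OF assms] convergent_imp_Bseq by blast
  then show ?thesis
    using that unfolding Bseq_def by auto
qed

lemma form_convergent:
  assumes f: "f \<in> FM_Cauchy X d" and g: "g \<in> FM_Cauchy X d"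
  shows "convergent (\<lambda>n. W_form d (f n) (g n))"
proof (rule Cauchy_convergent, rule metric_CauchyI)
  fix e :: real assume e: "e > 0"
  obtain K where K: "K > 0" "\<And>n. FM_norm d (f n) \<le> K"
    using seminorm_bounded[OF f] by blast
  obtain L where L: "L > 0" "\<And>n. FM_norm d (g n) \<le> L"
    using seminorm_bounded[OF g] by blast
  define e' where "e' = e / (K + L)"
  have e': "e' > 0"
    using e K L by (simp add: e'_def)
  obtain M where M: "\<And>m n. m \<ge> M \<Longrightarrow> n \<ge> M \<Longrightarrow> FM_norm d (f m - f n) < e'"
    using FM_CauchyD[OF f e'] by blast
  obtain N where N: "\<And>m n. m \<ge> N \<Longrightarrow> n \<ge> N \<Longrightarrow> FM_norm d (g m - g n) < e'"
    using FM_CauchyD[OF g e'] by blast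
  show "\<exists>M. \<forall>m\<ge>M. \<forall>n\<ge>M. dist (W_form d (f m) (g m)) (W_form d (f n) (g n)) < e"
  proof (intro exI[of _ "max M N"] allI impI)
    fix m n assume mn: "max M N \<le> m" "max M N \<le> n"
    have "W_form d (f m) (g m) - W_form d (f n) (g n) =
        W_form d (f m - f n) (g m) + W_form d (f n) (g m - g n)"
      by (simp add: W_form_diff_left form_diff_right)
    then have "dist (W_form d (f m) (g m)) (W_form d (f n) (g n)) \<le>
        FM_norm d (f m - f n) * FM_norm d (g m) + FM_norm d (f n) * FM_norm d (g m - g n)"
      unfolding dist_norm using norm_triangle_mono[OF cauchy_schwarz cauchy_schwarz] by metis
    also have "\<dots> \<le> FM_norm d (f m - f n) * L + K * FM_norm d (g m - g n)"
      by (intro add_mono mult_left_mono mult_right_mono K L) auto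
    also have "\<dots> < e' * L + K * e'"
      using M[of m n] N[of m n] mn K L by (intro add_strict_mono mult_strict_right_mono mult_strict_left_mono) auto
    also have "\<dots> = e' * (K + L)"
      by (simp add: algebra_simps)
    also have "\<dots> = e"
      using K L by (simp add: e'_def)
    finally show "dist (W_form d (f m) (g m)) (W_form d (f n) (g n)) < e" .
  qed
qed

lemma Cauchy_diff:
  assumes f: "f \<in> FM_Cauchy X d" and g: "g \<in> FM_Cauchy X d"
  shows "(\<lambda>n. f n - g n) \<in> FM_Cauchy X d"
proof -
  have "\<exists>M. \<forall>m\<ge>M. \<forall>n\<ge>M. FM_norm d ((f m - g m) - (f n - g n)) < e" if e: "e > 0" for e
  proof -
    obtain M where M: "\<And>m n. m \<ge> M \<Longrightarrow> n \<ge> M \<Longrightarrow> FM_norm d (f m - f n) < e / 2"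
      using FM_CauchyD[OF f] e half_gt_zero by blast
    obtain N where N: "\<And>m n. m \<ge> N \<Longrightarrow> n \<ge> N \<Longrightarrow> FM_norm d (g m - g n) < e / 2"
      using FM_CauchyD[OF g] e half_gt_zero by blast
    show ?thesis
    proof (intro exI[of _ "max M N"] allI impI)
      fix m n assume mn: "max M N \<le> m" "max M N \<le> n"
      show "FM_norm d ((f m - g m) - (f n - g n)) < e"
        using seminorm_diff_diff_le[of "f m" "g m" "f n" "g n"] M[of m n] N[of m n] mn by simp
    qed
  qed
  then show ?thesis
    using f g by (auto simp: FM_Cauchy_def FM_diff)
qed

lemma Cauchy_const: "\<mu> \<in> FM X \<Longrightarrow> (\<lambda>_. \<mu>) \<in> FM_Cauchy X d"
  by (simp add: FM_Cauchy_def)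

lemma equiv_W_rel: "equiv (FM_Cauchy X d) (W_rel X d)"
proof (rule equivI)
  show "W_rel X d \<subseteq> FM_Cauchy X d \<times> FM_Cauchy X d"
    by (auto simp: W_rel_def)
  show "refl_on (FM_Cauchy X d) (W_rel X d)"
    by (auto simp: W_rel_def refl_on_def)
  show "sym (W_rel X d)"
    by (auto simp: W_rel_def sym_def seminorm_minus_commute)
  show "trans (W_rel X d)"
  proof (rule transI)
    fix f g h assume "(f, g) \<in> W_rel X d" "(g, h) \<in> W_rel X d"
    then have lim: "(\<lambda>n. FM_norm d (f n - g n) + FM_norm d (g n - h n)) \<longlonglongrightarrow> 0"
      and fh: "f \<in> FM_Cauchy X d" "h \<in> FM_Cauchy X d"
      using tendsto_add[of "\<lambda>n. FM_norm d (f n - g n)" 0 sequentially "\<lambda>n. FM_norm d (g n - h n)" 0]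
      by (auto simp: W_rel_def)
    have "(\<lambda>n. FM_norm d (f n - h n)) \<longlonglongrightarrow> 0"
      by (rule tendsto_sandwich[OF _ _ tendsto_const lim])
         (auto intro!: always_eventually seminorm_triangle_diff)
    then show "(f, h) \<in> W_rel X d"
      using fh by (simp add: W_rel_def)
  qed
qed

text \<open>
  This makes the limit defining the inner product of two classes independent of the
  representatives, so that it can be computed from any of them.
\<close>

lemma form_limit_respects:
  assumes ff: "(f, f') \<in> W_rel X d" and gg: "(g, g') \<in> W_rel X d"
    and lim: "(\<lambda>n. W_form d (f n) (g n)) \<longlonglongrightarrow> z"
  shows "(\<lambda>n. W_form d (f' n) (g' n)) \<longlonglongrightarrow> z"
proof -
  have C: "f' \<in> FM_Cauchy X d" "g \<in> FM_Cauchy X d"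
    and l: "(\<lambda>n. FM_norm d (f n - f' n)) \<longlonglongrightarrow> 0" "(\<lambda>n. FM_norm d (g n - g' n)) \<longlonglongrightarrow> 0"
    using ff gg by (auto simp: W_rel_def)
  obtain K where K: "K > 0" "\<And>n. FM_norm d (f' n) \<le> K"
    using seminorm_bounded[OF C(1)] by blast
  obtain L where L: "L > 0" "\<And>n. FM_norm d (g n) \<le> L"
    using seminorm_bounded[OF C(2)] by blast
  have "(\<lambda>n. W_form d (f n) (g n) - W_form d (f' n) (g' n)) \<longlonglongrightarrow> 0"
  proof (rule Lim_null_comparison)
    have "(\<lambda>n. FM_norm d (f n - f' n) * L + K * FM_norm d (g n - g' n)) \<longlonglongrightarrow> 0 * L + K * 0"
      by (intro tendsto_intros l)
    then show "(\<lambda>n. FM_norm d (f n - f' n) * L + K * FM_norm d (g n - g' n)) \<longlonglongrightarrow> 0"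
      by simp
    show "\<forall>\<^sub>F n in sequentially. cmod (W_form d (f n) (g n) - W_form d (f' n) (g' n)) \<le>
        FM_norm d (f n - f' n) * L + K * FM_norm d (g n - g' n)"
    proof (rule always_eventually, rule allI)
      fix n
      have "W_form d (f n) (g n) - W_form d (f' n) (g' n) =
          W_form d (f n - f' n) (g n) + W_form d (f' n) (g n - g' n)"
        by (simp add: W_form_diff_left form_diff_right)
      then have "cmod (W_form d (f n) (g n) - W_form d (f' n) (g' n)) \<le>
          FM_norm d (f n - f' n) * FM_norm d (g n) + FM_norm d (f' n) * FM_norm d (g n - g' n)"
        using norm_triangle_mono[OF cauchy_schwarz cauchy_schwarz] by metis
      also have "\<dots> \<le> FM_norm d (f n - f' n) * L + K * FM_norm d (g n - g' n)"
        by (intro add_mono mult_left_mono mult_right_mono K L) auto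
      finally show "cmod (W_form d (f n) (g n) - W_form d (f' n) (g' n)) \<le>
          FM_norm d (f n - f' n) * L + K * FM_norm d (g n - g' n)" .
    qed
  qed
  from tendsto_diff[OF lim this] show ?thesis
    by simp
qed

abbreviation cls :: "'a set \<Rightarrow> (nat \<Rightarrow> 'a \<Rightarrow>\<^sub>0 complex) \<Rightarrow> (nat \<Rightarrow> 'a \<Rightarrow>\<^sub>0 complex) set" where
  "cls X f \<equiv> W_rel X d `` {f}"

lemma cls_self: "f \<in> FM_Cauchy X d \<Longrightarrow> f \<in> cls X f"
  using equiv_class_self[OF equiv_W_rel] by blast

lemma W_inner_cls:
  assumes f: "f \<in> FM_Cauchy X d" and g: "g \<in> FM_Cauchy X d"
  shows "(\<lambda>n. W_form d (f n) (g n)) \<longlonglongrightarrow> W_inner d (cls X f) (cls X g)"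
proof -
  obtain z where z: "(\<lambda>n. W_form d (f n) (g n)) \<longlonglongrightarrow> z"
    using form_convergent[OF f g] by (auto simp: convergent_def)
  have "W_inner d (cls X f) (cls X g) = z"
    unfolding W_inner_def
  proof (rule the_equality)
    show "\<forall>f'\<in>cls X f. \<forall>g'\<in>cls X g. (\<lambda>n. W_form d (f' n) (g' n)) \<longlonglongrightarrow> z"
      using form_limit_respects[OF _ _ z] by blast
    show "z' = z" if "\<forall>f'\<in>cls X f. \<forall>g'\<in>cls X g. (\<lambda>n. W_form d (f' n) (g' n)) \<longlonglongrightarrow> z'" for z'
      using that cls_self[OF f] cls_self[OF g] z LIMSEQ_unique by blast
  qed
  with z show ?thesis
    by simp
qed

lemma W_norm_cls:
  assumes f: "f \<in> FM_Cauchy X d"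
  shows "(\<lambda>n. FM_norm d (f n)) \<longlonglongrightarrow> W_norm d (cls X f)"
  unfolding W_norm_def FM_norm_def by (intro tendsto_intros W_inner_cls f)

lemma W_minus_cls:
  assumes f: "f \<in> FM_Cauchy X d" and g: "g \<in> FM_Cauchy X d"
  shows "W_minus X d (cls X f) (cls X g) = cls X (\<lambda>n. f n - g n)"
proof -
  have "cls X (\<lambda>n. f' n - g' n) = cls X (\<lambda>n. f n - g n)" if "f' \<in> cls X f" "g' \<in> cls X g" for f' g'
  proof -
    have C: "f' \<in> FM_Cauchy X d" "g' \<in> FM_Cauchy X d"
      and l: "(\<lambda>n. FM_norm d (f n - f' n)) \<longlonglongrightarrow> 0" "(\<lambda>n. FM_norm d (g n - g' n)) \<longlonglongrightarrow> 0"
      using that by (auto simp: W_rel_def)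
    from tendsto_add[OF l] have lim: "(\<lambda>n. FM_norm d (f n - f' n) + FM_norm d (g n - g' n)) \<longlonglongrightarrow> 0"
      by simp
    have "(\<lambda>n. FM_norm d ((f n - g n) - (f' n - g' n))) \<longlonglongrightarrow> 0"
      by (rule tendsto_sandwich[OF _ _ tendsto_const lim])
         (auto intro!: always_eventually seminorm_diff_diff_le)
    then have "((\<lambda>n. f n - g n), (\<lambda>n. f' n - g' n)) \<in> W_rel X d"
      using Cauchy_diff f g C by (simp add: W_rel_def)
    then show ?thesis
      using equiv_class_eq[OF equiv_W_rel] by metis
  qed
  then show ?thesis
    unfolding W_minus_def using cls_self[OF f] cls_self[OF g] by blast
qed

lemma W_space_cases:
  assumes "w \<in> W_space X d"
  obtains f where "f \<in> FM_Cauchy X d" "w = cls X f"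
  using assms unfolding W_space_def by (rule quotientE)

lemma cls_in_W_space: "f \<in> FM_Cauchy X d \<Longrightarrow> cls X f \<in> W_space X d"
  unfolding W_space_def by (rule quotientI)

lemma W_norm_diff_embed:
  assumes "f \<in> FM_Cauchy X d" "\<mu> \<in> FM X"
  shows "(\<lambda>n. FM_norm d (f n - \<mu>)) \<longlonglongrightarrow> W_norm d (W_minus X d (cls X f) (W_embed X d \<mu>))"
  unfolding W_embed_def using assms
  by (simp add: W_minus_cls Cauchy_const W_norm_cls Cauchy_diff)

lemma Z_op_cls:
  assumes "f \<in> FM_Cauchy X d" "x \<in> X"
  shows "(\<lambda>n. W_form d (f n) (point_mass x)) \<longlonglongrightarrow> Z_op X d (cls X f) x"
  unfolding Z_op_def W_embed_def
  using assms by (intro W_inner_cls Cauchy_const point_mass_FM)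

lemma form_tendsto_of_point_masses:
  assumes "\<And>a. a \<in> A \<Longrightarrow> (\<lambda>n. W_form d (f n) (point_mass a)) \<longlonglongrightarrow> z" and "\<nu> \<in> FM A"
  shows "(\<lambda>n. W_form d (f n) \<nu>) \<longlonglongrightarrow> z * cnj (total_mass \<nu>)"
proof -
  have "(\<lambda>n. \<Sum>b\<in>Poly_Mapping.keys \<nu>. W_form d (f n) (point_mass b) * cnj (Poly_Mapping.lookup \<nu> b))
      \<longlonglongrightarrow> (\<Sum>b\<in>Poly_Mapping.keys \<nu>. z * cnj (Poly_Mapping.lookup \<nu> b))"
    using assms by (intro tendsto_sum tendsto_mult tendsto_const) (auto simp: FM_def)
  then show ?thesis
    by (subst W_form_eq_sum_point_mass) (simp add: total_mass_def sum_distrib_left)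
qed

text \<open>
  The difference of two weightings is orthogonal to all measures on \<open>A\<close> and is itself a limit of such
  measures, hence it has norm zero.
\<close>

lemma weighting_unique:
  assumes AX: "A \<subseteq> X" and w: "is_weighting X d A w" and w': "is_weighting X d A w'"
  shows "w = w'"
proof -
  obtain f where f: "f \<in> FM_Cauchy X d" "w = cls X f"
    using w by (auto simp: is_weighting_def W_sub_def elim: W_space_cases)
  obtain g where g: "g \<in> FM_Cauchy X d" "w' = cls X g"
    using w' by (auto simp: is_weighting_def W_sub_def elim: W_space_cases)
  define h where "h = (\<lambda>n. f n - g n)"
  have h: "h \<in> FM_Cauchy X d"
    unfolding h_def by (rule Cauchy_diff) fact+
  define L where "L = W_norm d (cls X h)"
  have hL: "(\<lambda>n. FM_norm d (h n)) \<longlonglongrightarrow> L"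
    unfolding L_def by (rule W_norm_cls[OF h])
  have "(\<lambda>n. W_form d (h n) (point_mass a)) \<longlonglongrightarrow> 0" if a: "a \<in> A" for a
  proof -
    have "(\<lambda>n. W_form d (f n) (point_mass a)) \<longlonglongrightarrow> 1" "(\<lambda>n. W_form d (g n) (point_mass a)) \<longlonglongrightarrow> 1"
      using Z_op_cls[OF f(1)] Z_op_cls[OF g(1)] w w' a AX unfolding is_weighting_def f g
      by (metis subsetD)+
    from tendsto_diff[OF this] show ?thesis
      by (simp add: h_def W_form_diff_left)
  qed
  then have h0: "(\<lambda>n. W_form d (h n) \<nu>) \<longlonglongrightarrow> 0" if "\<nu> \<in> FM A" for \<nu>
    using form_tendsto_of_point_masses[of A h 0 \<nu>] that by simp
  have L0: "0 \<le> L"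
    using hL by (rule LIMSEQ_le_const) simp
  have "L\<^sup>2 \<le> L * (e + e)" if e: "e > 0" for e
  proof -
    obtain \<mu> where \<mu>: "\<mu> \<in> FM A" "W_norm d (W_minus X d w (W_embed X d \<mu>)) < e"
      using w e by (auto simp: is_weighting_def W_sub_def)
    obtain \<mu>' where \<mu>': "\<mu>' \<in> FM A" "W_norm d (W_minus X d w' (W_embed X d \<mu>')) < e"
      using w' e by (auto simp: is_weighting_def W_sub_def)
    have inX: "\<mu> \<in> FM X" "\<mu>' \<in> FM X"
      using \<mu>(1) \<mu>'(1) FM_mono[OF AX] by auto
    have lim: "(\<lambda>n. FM_norm d (h n) * (FM_norm d (f n - \<mu>) + FM_norm d (g n - \<mu>')) +
          cmod (W_form d (h n) (\<mu> - \<mu>'))) \<longlonglongrightarrow>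
        L * (W_norm d (W_minus X d w (W_embed X d \<mu>)) + W_norm d (W_minus X d w' (W_embed X d \<mu>'))) + cmod 0"
      unfolding f(2) g(2) using f(1) g(1) inX
      by (intro tendsto_intros hL h0 FM_diff \<mu> \<mu>' W_norm_diff_embed)
    have "(FM_norm d (h n))\<^sup>2 \<le> FM_norm d (h n) * (FM_norm d (f n - \<mu>) + FM_norm d (g n - \<mu>')) +
          cmod (W_form d (h n) (\<mu> - \<mu>'))" for n
    proof -
      have "(FM_norm d (h n))\<^sup>2 = cmod (W_form d (h n) (h n))"
        by (simp add: form_self norm_power)
      also have "W_form d (h n) (h n) = W_form d (h n) (h n - (\<mu> - \<mu>')) + W_form d (h n) (\<mu> - \<mu>')"
        by (simp add: form_diff_right)
      also have "cmod \<dots> \<le> FM_norm d (h n) * FM_norm d (h n - (\<mu> - \<mu>')) + cmod (W_form d (h n) (\<mu> - \<mu>'))"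
        by (rule norm_triangle_mono[OF cauchy_schwarz]) simp
      also have "FM_norm d (h n - (\<mu> - \<mu>')) \<le> FM_norm d (f n - \<mu>) + FM_norm d (g n - \<mu>')"
        unfolding h_def by (rule seminorm_diff_diff_le)
      finally show ?thesis
        by (simp add: mult_left_mono)
    qed
    then have "L\<^sup>2 \<le> L * (W_norm d (W_minus X d w (W_embed X d \<mu>)) + W_norm d (W_minus X d w' (W_embed X d \<mu>'))) + cmod 0"
      by (intro LIMSEQ_le[OF tendsto_power[OF hL] lim]) auto
    also have "\<dots> \<le> L * (e + e)"
      using \<mu> \<mu>' L0 by (simp add: mult_left_mono)
    finally show ?thesis .
  qed
  from this[of "L / 4"] have "L = 0"
    using L0 by (cases "L = 0") (auto simp: power2_eq_square)
  then have "(f, g) \<in> W_rel X d"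
    using hL f g by (simp add: W_rel_def h_def)
  then show ?thesis
    using f g equiv_class_eq[OF equiv_W_rel] by metis
qed

text \<open>
  Minimise \<open>J \<mu> = \<parallel>\<mu>\<parallel>\<^sup>2 - 2 Re (\<mu>(A))\<close> over the measures on \<open>A\<close>; the assumed bound makes \<open>J\<close> bounded below.
  By the parallelogram law a minimising sequence is Cauchy, and since variations of it cannot decrease \<open>J\<close>
  by much, its inner products with \<open>\<nu>\<close> tend to the conjugate of \<open>\<nu>(A)\<close>. Its class is therefore a
  weighting.
\<close>

theorem magnitude_variational:
  assumes AX: "A \<subseteq> X" and B: "0 \<le> B"
    and bound: "\<And>\<mu>. \<mu> \<in> FM A \<Longrightarrow> (cmod (total_mass \<mu>))\<^sup>2 \<le> B * (FM_norm d \<mu>)\<^sup>2"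
  obtains m where "magnitude X d A = ereal m" "0 \<le> m" "m \<le> B"
    "\<And>\<nu>. \<nu> \<in> FM A \<Longrightarrow> (cmod (total_mass \<nu>))\<^sup>2 \<le> m * (FM_norm d \<nu>)\<^sup>2"
proof -
  define J where "J \<mu> = (FM_norm d \<mu>)\<^sup>2 - 2 * Re (total_mass \<mu>)" for \<mu>
  define m where "m = Inf (J ` FM A)"
  have "- B \<le> J \<mu>" if "\<mu> \<in> FM A" for \<mu>
  proof -
    have "(cmod (total_mass \<mu>))\<^sup>2 \<le> B * (FM_norm d \<mu>)\<^sup>2"
      by (rule bound[OF that])
    also have "\<dots> \<le> ((B + (FM_norm d \<mu>)\<^sup>2) / 2)\<^sup>2"
      using zero_le_power2[of "B - (FM_norm d \<mu>)\<^sup>2"] by (simp add: power2_eq_square field_simps)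
    finally have "cmod (total_mass \<mu>) \<le> (B + (FM_norm d \<mu>)\<^sup>2) / 2"
      by (rule power2_le_imp_le) (use B in simp)
    then show ?thesis
      using complex_Re_le_cmod[of "total_mass \<mu>"] by (simp add: J_def)
  qed
  then have bdd: "bdd_below (J ` FM A)"
    by (auto intro!: bdd_belowI)
  then have m_le: "m \<le> J \<mu>" if "\<mu> \<in> FM A" for \<mu>
    unfolding m_def using that by (auto intro: cInf_lower)
  have "0 \<in> FM A"
    by (simp add: FM_def)
  then have "\<exists>\<mu>\<in>FM A. J \<mu> < m + 1 / real (Suc n)" for n
    using cInf_lessD[of "J ` FM A" "m + 1 / real (Suc n)"] by (force simp: m_def)
  then obtain f where fA: "\<And>n. f n \<in> FM A" and fJ: "\<And>n. J (f n) < m + 1 / real (Suc n)"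
    by metis
  have fX: "f n \<in> FM X" for n
    using fA FM_mono[OF AX] by blast
  \<comment> \<open>the parallelogram law; the midpoint cannot undercut the infimum\<close>
  have mid: "(FM_norm d (f k - f l))\<^sup>2 < 2 / real (Suc k) + 2 / real (Suc l)" for k l
  proof -
    have "(FM_norm d (f k - f l))\<^sup>2 =
        2 * J (f k) + 2 * J (f l) - 4 * J (scale_FM (1/2) (f k + f l))"
      unfolding J_def seminorm_scale total_mass_scale total_mass_add power_mult_distrib seminorm_add_sq seminorm_diff_sq
      by (simp add: norm_divide power_divide field_simps)
    moreover have "m \<le> J (scale_FM (1/2) (f k + f l))"
      by (intro m_le FM_scale FM_add fA)
    ultimately show ?thesis
      using fJ[of k] fJ[of l] by simp
  qed
  have "\<exists>M. \<forall>k\<ge>M. \<forall>l\<ge>M. FM_norm d (f k - f l) < e" if e: "e > 0" for e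
  proof -
    obtain M where M: "4 / e\<^sup>2 < real M"
      using reals_Archimedean2 by blast
    show ?thesis
    proof (intro exI[of _ M] allI impI)
      fix k l assume kl: "M \<le> k" "M \<le> l"
      have "0 < real M"
      proof -
        have "0 < 4 / e\<^sup>2"
          using e by simp
        with M show ?thesis
          by linarith
      qed
      then have "2 / real (Suc k) \<le> 2 / real M" "2 / real (Suc l) \<le> 2 / real M"
        using kl by (auto intro!: divide_left_mono)
      then have "(FM_norm d (f k - f l))\<^sup>2 < 4 / real M"
        using mid[of k l] by simp
      also have "\<dots> < e\<^sup>2"
        using M e \<open>0 < real M\<close> by (simp add: field_simps)
      finally show "FM_norm d (f k - f l) < e"
        using e by (simp add: power2_less_imp_less)
    qed
  qed
  then have f: "f \<in> FM_Cauchy X d"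
    using fX by (auto simp: FM_Cauchy_def)
  obtain K where K: "K > 0" "\<And>n. FM_norm d (f n) \<le> K"
    using seminorm_bounded[OF f] by blast
  have stationary: "(cmod (W_form d (f n) \<nu> - cnj (total_mass \<nu>)))\<^sup>2 \<le>
      ((FM_norm d \<nu>)\<^sup>2 + 1) * (1 / real (Suc n))" if \<nu>: "\<nu> \<in> FM A" for \<nu> n
  proof -
    define z where "z = W_form d (f n) \<nu> - cnj (total_mass \<nu>)"
    define N where "N = (FM_norm d \<nu>)\<^sup>2"
    \<comment> \<open>the optimal step would be \<open>1 / N\<close>; enlarging the denominator covers \<open>N = 0\<close> as well\<close>
    define s where "s = 1 / (N + 1)"
    have N: "0 \<le> N" and s: "0 < s" "s * N \<le> 1"
      by (auto simp: N_def s_def field_simps add_pos_nonneg)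
    define c where "c = - of_real s * z"
    have "m \<le> J (f n + scale_FM c \<nu>)"
      by (intro m_le FM_scale FM_add fA \<nu>)
    also have "J (f n + scale_FM c \<nu>) = J (f n) + 2 * Re (cnj c * z) + (cmod c)\<^sup>2 * N"
      unfolding J_def seminorm_add_sq seminorm_scale total_mass_scale total_mass_add form_scale_right z_def N_def
      by (simp add: power_mult_distrib algebra_simps)
    also have "Re (cnj c * z) = - s * (cmod z)\<^sup>2"
      by (simp add: c_def cmod_power2) (simp add: power2_eq_square algebra_simps)
    also have "(cmod c)\<^sup>2 * N = s * (s * N) * (cmod z)\<^sup>2"
      using s by (simp add: c_def norm_mult power_mult_distrib power2_eq_square)
    also have "\<dots> \<le> s * 1 * (cmod z)\<^sup>2"
      using s by (intro mult_right_mono mult_left_mono) auto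
    finally have "s * (cmod z)\<^sup>2 \<le> 1 / real (Suc n)"
      using fJ[of n] by simp
    then have "(cmod z)\<^sup>2 / (N + 1) \<le> 1 / real (Suc n)"
      by (simp add: s_def)
    then have "(cmod z)\<^sup>2 \<le> 1 / real (Suc n) * (N + 1)"
      using N by (subst (asm) pos_divide_le_eq) auto
    then show ?thesis
      by (simp only: z_def N_def mult.commute)
  qed
  have inv_lim: "(\<lambda>n. C * (1 / real (Suc n))) \<longlonglongrightarrow> 0" for C
    using tendsto_mult[OF tendsto_const[of C] LIMSEQ_inverse_real_of_nat] by (simp add: inverse_eq_divide)
  have f_lim: "(\<lambda>n. W_form d (f n) \<nu>) \<longlonglongrightarrow> cnj (total_mass \<nu>)" if \<nu>: "\<nu> \<in> FM A" for \<nu>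
  proof -
    have "(\<lambda>n. (cmod (W_form d (f n) \<nu> - cnj (total_mass \<nu>)))\<^sup>2) \<longlonglongrightarrow> 0"
    proof (rule tendsto_sandwich[OF _ _ tendsto_const inv_lim[of "(FM_norm d \<nu>)\<^sup>2 + 1"]])
      show "\<forall>\<^sub>F n in sequentially. (cmod (W_form d (f n) \<nu> - cnj (total_mass \<nu>)))\<^sup>2 \<le>
          ((FM_norm d \<nu>)\<^sup>2 + 1) * (1 / real (Suc n))"
        by (intro always_eventually allI stationary \<nu>)
    qed simp
    then have "(\<lambda>n. W_form d (f n) \<nu> - cnj (total_mass \<nu>)) \<longlonglongrightarrow> 0"
      by (simp add: tendsto_norm_zero_iff)
    then show ?thesis
      by (rule LIM_zero_cancel)
  qed
  have weighting: "is_weighting X d A (cls X f)"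
    unfolding is_weighting_def
  proof
    have "\<exists>\<mu>\<in>FM A. W_norm d (W_minus X d (cls X f) (W_embed X d \<mu>)) < e" if e: "e > 0" for e
    proof -
      obtain M where M: "\<And>k l. k \<ge> M \<Longrightarrow> l \<ge> M \<Longrightarrow> FM_norm d (f k - f l) < e / 2"
        using FM_CauchyD[OF f] e half_gt_zero by blast
      have "W_norm d (W_minus X d (cls X f) (W_embed X d (f M))) \<le> e / 2"
        by (rule LIMSEQ_le_const2[OF W_norm_diff_embed[OF f fX]]) (use M in \<open>force intro: less_imp_le\<close>)
      then show ?thesis
        using e fA by (intro bexI[of _ "f M"]) auto
    qed
    then show "cls X f \<in> W_sub X d A"
      by (simp add: W_sub_def cls_in_W_space f)
    show "\<forall>a\<in>A. Z_op X d (cls X f) a = 1"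
    proof
      fix a assume a: "a \<in> A"
      have "(\<lambda>n. W_form d (f n) (point_mass a)) \<longlonglongrightarrow> 1"
        using f_lim[OF point_mass_FM[OF a]] by simp
      then show "Z_op X d (cls X f) a = 1"
        using Z_op_cls[OF f] a AX LIMSEQ_unique by blast
    qed
  qed
  define v where "v = W_norm d (cls X f)"
  have v_lim: "(\<lambda>n. FM_norm d (f n)) \<longlonglongrightarrow> v"
    unfolding v_def by (rule W_norm_cls[OF f])
  have "(THE w. is_weighting X d A w) = cls X f"
    using weighting weighting_unique[OF AX] by (intro the_equality) auto
  then have mag: "magnitude X d A = ereal (v\<^sup>2)"
    unfolding magnitude_def v_def using weighting by auto
  have lower: "(cmod (total_mass \<nu>))\<^sup>2 \<le> v\<^sup>2 * (FM_norm d \<nu>)\<^sup>2" if \<nu>: "\<nu> \<in> FM A" for \<nu>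
  proof (rule LIMSEQ_le)
    show "(\<lambda>n. (cmod (W_form d (f n) \<nu>))\<^sup>2) \<longlonglongrightarrow> (cmod (total_mass \<nu>))\<^sup>2"
      using tendsto_power[OF tendsto_norm[OF f_lim[OF \<nu>]], of 2] by simp
    show "(\<lambda>n. (FM_norm d (f n))\<^sup>2 * (FM_norm d \<nu>)\<^sup>2) \<longlonglongrightarrow> v\<^sup>2 * (FM_norm d \<nu>)\<^sup>2"
      by (intro tendsto_intros v_lim)
  qed (use cauchy_schwarz_sq in auto)
  have "v\<^sup>2 \<le> B"
  proof -
    have "(\<lambda>n. W_form d (f n) (f n) - cnj (total_mass (f n))) \<longlonglongrightarrow> 0"
    proof -
      have "(\<lambda>n. (cmod (W_form d (f n) (f n) - cnj (total_mass (f n))))\<^sup>2) \<longlonglongrightarrow> 0"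
      proof (rule tendsto_sandwich[OF _ _ tendsto_const inv_lim[of "K\<^sup>2 + 1"]])
        show "\<forall>\<^sub>F n in sequentially. (cmod (W_form d (f n) (f n) - cnj (total_mass (f n))))\<^sup>2 \<le>
            (K\<^sup>2 + 1) * (1 / real (Suc n))"
        proof (rule always_eventually, rule allI)
          fix n
          have "((FM_norm d (f n))\<^sup>2 + 1) * (1 / real (Suc n)) \<le> (K\<^sup>2 + 1) * (1 / real (Suc n))"
            using K by (intro mult_right_mono add_right_mono power_mono) auto
          then show "(cmod (W_form d (f n) (f n) - cnj (total_mass (f n))))\<^sup>2 \<le>
            (K\<^sup>2 + 1) * (1 / real (Suc n))"
            using stationary[OF fA, of n n] by linarith
        qed
      qed auto
      then show ?thesis
        by (simp add: tendsto_norm_zero_iff)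
    qed
    moreover have "(\<lambda>n. W_form d (f n) (f n)) \<longlonglongrightarrow> complex_of_real (v\<^sup>2)"
      unfolding form_self by (intro tendsto_intros v_lim)
    ultimately have "(\<lambda>n. cnj (total_mass (f n))) \<longlonglongrightarrow> complex_of_real (v\<^sup>2)"
      using tendsto_diff by fastforce
    then have "(\<lambda>n. (cmod (total_mass (f n)))\<^sup>2) \<longlonglongrightarrow> (cmod (complex_of_real (v\<^sup>2)))\<^sup>2"
      using tendsto_power[OF tendsto_norm, of "\<lambda>n. cnj (total_mass (f n))"] by simp
    moreover have "(\<lambda>n. B * (FM_norm d (f n))\<^sup>2) \<longlonglongrightarrow> B * v\<^sup>2"
      by (intro tendsto_intros v_lim)
    ultimately have "(cmod (complex_of_real (v\<^sup>2)))\<^sup>2 \<le> B * v\<^sup>2"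
      by (rule LIMSEQ_le) (use bound fA in blast)
    then have "v\<^sup>2 * v\<^sup>2 \<le> B * v\<^sup>2"
      unfolding norm_of_real abs_power2 by (simp only: power2_eq_square[of "v\<^sup>2"])
    then have "v\<^sup>2 \<le> B" if "v \<noteq> 0"
      using that by (intro mult_right_le_imp_le[of "v\<^sup>2" "v\<^sup>2" B]) auto
    then show ?thesis
      using B by (cases "v = 0") auto
  qed
  with mag lower show ?thesis
    by (intro that[of "v\<^sup>2"]) auto
qed

end

section \<open>Random partitions by independent cuts\<close>

definition separates :: "'a set \<Rightarrow> 'a \<Rightarrow> 'a \<Rightarrow> bool" where
  "separates S a b \<longleftrightarrow> (a \<in> S) \<noteq> (b \<in> S)"

definition cuts :: "'a set \<Rightarrow> 'a set \<Rightarrow> bool" where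
  "cuts S G \<longleftrightarrow> (\<exists>a\<in>G. \<exists>b\<in>G. separates S a b)"

text \<open>
  The cells of the partition generated by a set \<open>T\<close> of cuts are the fibres of this map: it records on
  which side of each cut a point lies.
\<close>

definition cell :: "'a set set \<Rightarrow> 'a \<Rightarrow> 'a set set" where
  "cell T a = {S \<in> T. a \<in> S}"

lemma cell_eq_iff: "cell T a = cell T b \<longleftrightarrow> (\<forall>S\<in>T. \<not> separates S a b)"
  by (auto simp: cell_def separates_def)

text \<open>
  The probability of \<open>T\<close> if every cut \<open>S\<close> in \<open>P\<close> is selected independently with probability
  \<open>1 - exp (- w S)\<close>, as for a Poisson process of intensity \<open>w\<close> with multiple points ignored.
\<close>

definition subset_prob :: "('a set \<Rightarrow> real) \<Rightarrow> 'a set set \<Rightarrow> 'a set set \<Rightarrow> real" where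
  "subset_prob w P T = (\<Prod>S\<in>T. 1 - exp (- w S)) * (\<Prod>S\<in>P - T. exp (- w S))"

lemma subset_prob_nonneg:
  assumes "\<And>S. S \<in> P \<Longrightarrow> 0 \<le> w S" "T \<subseteq> P"
  shows "0 \<le> subset_prob w P T"
  unfolding subset_prob_def using assms by (intro mult_nonneg_nonneg prod_nonneg) auto

lemma sum_subset_prob_prod:
  assumes "finite P"
  shows "(\<Sum>T\<in>Pow P. subset_prob w P T * (\<Prod>S\<in>T. g S)) =
    (\<Prod>S\<in>P. (1 - exp (- w S)) * g S + exp (- w S))"
  unfolding prod_add[OF assms] subset_prob_def by (simp add: prod.distrib mult_ac)

lemma sum_subset_prob: "finite P \<Longrightarrow> (\<Sum>T\<in>Pow P. subset_prob w P T) = 1"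
  using sum_subset_prob_prod[of P w "\<lambda>_. 1"] by simp

text \<open>
  Two points share a cell exactly if no cut that separates them is selected.
\<close>

lemma exp_cut_metric_eq:
  assumes "finite P"
  shows "exp (- (\<Sum>S\<in>P. if separates S a b then w S else 0)) =
    (\<Sum>T\<in>Pow P. subset_prob w P T * of_bool (cell T a = cell T b))"
proof -
  have "exp (- (\<Sum>S\<in>P. if separates S a b then w S else 0)) =
      (\<Prod>S\<in>P. (1 - exp (- w S)) * of_bool (\<not> separates S a b) + exp (- w S))"
    unfolding sum_negf[symmetric] exp_sum[OF assms] by (intro prod.cong) auto
  also have "\<dots> = (\<Sum>T\<in>Pow P. subset_prob w P T * (\<Prod>S\<in>T. of_bool (\<not> separates S a b)))"
    by (rule sum_subset_prob_prod[OF assms, symmetric])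
  also have "\<dots> = (\<Sum>T\<in>Pow P. subset_prob w P T * of_bool (cell T a = cell T b))"
  proof (intro sum.cong refl arg_cong[where f = "(*) _"])
    fix T assume "T \<in> Pow P"
    then have "finite T"
      using assms finite_subset by auto
    then show "(\<Prod>S\<in>T. of_bool (\<not> separates S a b)) = (of_bool (cell T a = cell T b) :: real)"
      unfolding cell_eq_iff by (auto simp: prod_zero_iff)
  qed
  finally show ?thesis .
qed

lemma partition_form_eq:
  fixes u :: "'a \<Rightarrow> complex"
  assumes "finite F"
  shows "(\<Sum>a\<in>F. \<Sum>b\<in>F. of_bool (c a = c b) * u a * cnj (u b)) =
    of_real (\<Sum>C\<in>c ` F. (cmod (\<Sum>a\<in>{a\<in>F. c a = C}. u a))\<^sup>2)"
proof -
  have "(\<Sum>a\<in>F. \<Sum>b\<in>F. of_bool (c a = c b) * u a * cnj (u b)) =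
      (\<Sum>a\<in>F. u a * cnj (\<Sum>b\<in>{b\<in>F. c b = c a}. u b))"
  proof (rule sum.cong[OF refl])
    fix a
    have "(\<Sum>b\<in>F. of_bool (c a = c b) * u a * cnj (u b)) = (\<Sum>b\<in>{b\<in>F. c b = c a}. u a * cnj (u b))"
      using assms by (intro sum.mono_neutral_cong_right) auto
    then show "(\<Sum>b\<in>F. of_bool (c a = c b) * u a * cnj (u b)) = u a * cnj (\<Sum>b\<in>{b\<in>F. c b = c a}. u b)"
      by (simp add: sum_distrib_left)
  qed
  also have "\<dots> = (\<Sum>C\<in>c ` F. \<Sum>a\<in>{a\<in>F. c a = C}. u a * cnj (\<Sum>b\<in>{b\<in>F. c b = c a}. u b))"
    by (rule sum.image_gen[OF assms])
  also have "\<dots> = (\<Sum>C\<in>c ` F. of_real ((cmod (\<Sum>a\<in>{a\<in>F. c a = C}. u a))\<^sup>2))"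
  proof (rule sum.cong[OF refl])
    fix C
    have "(\<Sum>a\<in>{a\<in>F. c a = C}. u a * cnj (\<Sum>b\<in>{b\<in>F. c b = c a}. u b)) =
        (\<Sum>a\<in>{a\<in>F. c a = C}. u a * cnj (\<Sum>b\<in>{b\<in>F. c b = C}. u b))"
      by (intro sum.cong) auto
    also have "\<dots> = (\<Sum>a\<in>{a\<in>F. c a = C}. u a) * cnj (\<Sum>b\<in>{b\<in>F. c b = C}. u b)"
      by (simp only: sum_distrib_right)
    finally show "(\<Sum>a\<in>{a\<in>F. c a = C}. u a * cnj (\<Sum>b\<in>{b\<in>F. c b = c a}. u b)) =
        of_real ((cmod (\<Sum>a\<in>{a\<in>F. c a = C}. u a))\<^sup>2)"
      using complex_norm_square[of "\<Sum>a\<in>{a\<in>F. c a = C}. u a"] by metis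
  qed
  finally show ?thesis
    by simp
qed

lemma total_le_partition_form:
  fixes u :: "'a \<Rightarrow> complex"
  assumes "finite F"
  shows "(cmod (\<Sum>a\<in>F. u a))\<^sup>2 \<le> real (card (c ` F)) * (\<Sum>C\<in>c ` F. (cmod (\<Sum>a\<in>{a\<in>F. c a = C}. u a))\<^sup>2)"
proof -
  have "cmod (\<Sum>a\<in>F. u a) \<le> (\<Sum>C\<in>c ` F. cmod (\<Sum>a\<in>{a\<in>F. c a = C}. u a))"
    by (subst sum.image_gen[OF assms, of u c]) (rule norm_sum)
  then have "(cmod (\<Sum>a\<in>F. u a))\<^sup>2 \<le> (\<Sum>C\<in>c ` F. cmod (\<Sum>a\<in>{a\<in>F. c a = C}. u a))\<^sup>2"
    by (intro power_mono) auto
  also have "\<dots> \<le> (\<Sum>C\<in>c ` F. (cmod (\<Sum>a\<in>{a\<in>F. c a = C}. u a))\<^sup>2) * real (card (c ` F))"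
    using sum_squared_le_sum_of_squares by blast
  finally show ?thesis
    by (simp add: mult.commute)
qed

text \<open>
  A cut that does not divide \<open>G\<close> has all of \<open>G\<close> on one side, so only the other cuts distinguish the cells
  of points of \<open>G\<close>.
\<close>

lemma card_cells_le:
  assumes "finite T"
  shows "card (cell T ` G) \<le> 2 ^ card {S \<in> T. cuts S G}"
proof -
  let ?K = "{S \<in> T. cuts S G}"
  have "inj_on (\<lambda>C. C \<inter> ?K) (cell T ` G)"
  proof (rule inj_onI, clarify)
    fix a b assume ab: "a \<in> G" "b \<in> G" "cell T a \<inter> ?K = cell T b \<inter> ?K"
    have "\<not> separates S a b" if "S \<in> T" for S
    proof (cases "cuts S G")
      case True
      have "S \<in> cell T a \<inter> ?K \<longleftrightarrow> S \<in> cell T b \<inter> ?K"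
        by (simp only: ab(3))
      with True that show ?thesis
        by (simp add: cell_def separates_def)
    next
      case False
      with ab(1,2) show ?thesis
        unfolding cuts_def by blast
    qed
    then show "cell T a = cell T b"
      by (simp add: cell_eq_iff)
  qed
  then have "card (cell T ` G) = card ((\<lambda>C. C \<inter> ?K) ` cell T ` G)"
    by (simp add: card_image)
  also have "\<dots> \<le> card (Pow ?K)"
    using assms by (intro card_mono) auto
  finally show ?thesis
    using assms by (simp add: card_Pow)
qed

text \<open>
  The expectation of \<open>2 ^ k\<close>, where \<open>k\<close> counts the selected cuts that divide \<open>G\<close>, is a product over the cuts by
  independence, with factors \<open>2 - exp (- w S) \<le> exp (w S)\<close>.
\<close>

lemma expected_cells_le:
  assumes P: "finite P" and w: "\<And>S. S \<in> P \<Longrightarrow> 0 \<le> w S"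
  shows "(\<Sum>T\<in>Pow P. subset_prob w P T * real (card (cell T ` G))) \<le> exp (\<Sum>S\<in>{S\<in>P. cuts S G}. w S)"
proof -
  let ?g = "\<lambda>S. if cuts S G then 2 else 1 :: real"
  have "(\<Sum>T\<in>Pow P. subset_prob w P T * real (card (cell T ` G))) \<le>
      (\<Sum>T\<in>Pow P. subset_prob w P T * (\<Prod>S\<in>T. ?g S))"
  proof (rule sum_mono)
    fix T assume T: "T \<in> Pow P"
    then have fin: "finite T"
      using P finite_subset by auto
    have "real (card (cell T ` G)) \<le> real (2 ^ card {S \<in> T. cuts S G})"
      by (rule of_nat_mono[OF card_cells_le[OF fin]])
    also have "\<dots> = (\<Prod>S\<in>T. ?g S)"
      using fin by (simp add: prod.If_cases Int_def)
    finally show "subset_prob w P T * real (card (cell T ` G)) \<le> subset_prob w P T * (\<Prod>S\<in>T. ?g S)"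
      using subset_prob_nonneg[of P w T] w T by (intro mult_left_mono) auto
  qed
  also have "\<dots> = (\<Prod>S\<in>P. (1 - exp (- w S)) * ?g S + exp (- w S))"
    by (rule sum_subset_prob_prod[OF P])
  also have "\<dots> \<le> (\<Prod>S\<in>P. exp (if cuts S G then w S else 0))"
  proof (rule prod_mono, rule conjI)
    fix S assume S: "S \<in> P"
    have "exp (- w S) \<le> 1"
      using w[OF S] by simp
    then show "0 \<le> (1 - exp (- w S)) * ?g S + exp (- w S)"
      by auto
    have "2 - exp (- w S) \<le> exp (w S)"
      using exp_ge_add_one_self[of "- w S"] exp_ge_add_one_self[of "w S"] by linarith
    then show "(1 - exp (- w S)) * ?g S + exp (- w S) \<le> exp (if cuts S G then w S else 0)"
      by auto
  qed
  also have "\<dots> = exp (\<Sum>S\<in>{S\<in>P. cuts S G}. w S)"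
    using P by (simp add: exp_sum[symmetric] sum.inter_filter)
  finally show ?thesis .
qed

text \<open>
  The form is the expected energy \<open>\<Sum>|\<mu>(C)|\<^sup>2\<close> of the random partition into cells. For a partition into
  \<open>n\<close> cells the energy is at least \<open>|\<mu>(F)|\<^sup>2 / n\<close>, and the mean of \<open>1 / n\<close> is at least the inverse of
  the mean of \<open>n\<close>.
\<close>

theorem cut_metric_form:
  fixes u :: "'a \<Rightarrow> complex"
  assumes F: "finite F" and P: "finite P" and w: "\<And>S. S \<in> P \<Longrightarrow> 0 \<le> w S"
    and d: "\<And>a b. a \<in> F \<Longrightarrow> b \<in> F \<Longrightarrow> d a b = (\<Sum>S\<in>P. if separates S a b then w S else 0)"
  defines "Q \<equiv> (\<Sum>a\<in>F. \<Sum>b\<in>F. of_real (exp (- d a b)) * u a * cnj (u b))"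
  shows "0 \<le> Re Q"
    and "\<lbrakk>finite I; F \<subseteq> (\<Union>i\<in>I. G i); \<And>i. i \<in> I \<Longrightarrow> (\<Sum>S\<in>{S\<in>P. cuts S (F \<inter> G i)}. w S) \<le> L\<rbrakk>
      \<Longrightarrow> (cmod (\<Sum>a\<in>F. u a))\<^sup>2 \<le> real (card I) * exp L * Re Q"
proof -
  define R where "R T = (\<Sum>C\<in>cell T ` F. (cmod (\<Sum>a\<in>{a\<in>F. cell T a = C}. u a))\<^sup>2)" for T
  define p where "p T = subset_prob w P T" for T
  have of_real_bool: "complex_of_real (of_bool b) = of_bool b" for b
    by simp
  have p: "0 \<le> p T" if "T \<in> Pow P" for T
    using that w by (auto simp: p_def intro!: subset_prob_nonneg)
  have R: "0 \<le> R T" for T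
    by (simp add: R_def sum_nonneg)
  have "Q = (\<Sum>a\<in>F. \<Sum>b\<in>F. \<Sum>T\<in>Pow P. of_real (p T) * (of_bool (cell T a = cell T b) * u a * cnj (u b)))"
    unfolding Q_def p_def
    by (intro sum.cong refl, simp add: d exp_cut_metric_eq[OF P])
       (simp add: sum_distrib_right sum_distrib_left mult_ac of_real_bool)
  also have "\<dots> = (\<Sum>a\<in>F. \<Sum>T\<in>Pow P. \<Sum>b\<in>F. of_real (p T) * (of_bool (cell T a = cell T b) * u a * cnj (u b)))"
    by (rule sum.cong[OF refl], rule sum.swap)
  also have "\<dots> = (\<Sum>T\<in>Pow P. \<Sum>a\<in>F. \<Sum>b\<in>F. of_real (p T) * (of_bool (cell T a = cell T b) * u a * cnj (u b)))"
    by (rule sum.swap)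
  also have "\<dots> = (\<Sum>T\<in>Pow P. of_real (p T) * (\<Sum>a\<in>F. \<Sum>b\<in>F. of_bool (cell T a = cell T b) * u a * cnj (u b)))"
    by (simp only: sum_distrib_left)
  also have "\<dots> = of_real (\<Sum>T\<in>Pow P. p T * R T)"
    unfolding partition_form_eq[OF F] R_def by simp
  finally have Q: "Re Q = (\<Sum>T\<in>Pow P. p T * R T)"
    by simp
  show "0 \<le> Re Q"
    unfolding Q using p R by (intro sum_nonneg mult_nonneg_nonneg) auto
  assume I: "finite I" and cover: "F \<subseteq> (\<Union>i\<in>I. G i)"
    and L: "\<And>i. i \<in> I \<Longrightarrow> (\<Sum>S\<in>{S\<in>P. cuts S (F \<inter> G i)}. w S) \<le> L"
  show "(cmod (\<Sum>a\<in>F. u a))\<^sup>2 \<le> real (card I) * exp L * Re Q"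
  proof (cases "F = {}")
    case True
    then show ?thesis
      by (simp add: Q_def)
  next
    case False
    define n where "n T = real (card (cell T ` F))" for T
    define N where "N = real (card I) * exp L"
    have "I \<noteq> {}"
      using False cover by auto
    then have N: "N > 0"
      using I by (auto simp: N_def card_gt_0_iff)
    have n: "n T > 0" for T
      using False F by (auto simp: n_def card_gt_0_iff)
    have "(\<Sum>T\<in>Pow P. p T * n T) \<le> (\<Sum>T\<in>Pow P. \<Sum>i\<in>I. p T * real (card (cell T ` (F \<inter> G i))))"
    proof (rule sum_mono)
      fix T assume T: "T \<in> Pow P"
      have eq: "cell T ` F = (\<Union>i\<in>I. cell T ` (F \<inter> G i))"
        using cover by blast
      have "card (cell T ` F) \<le> (\<Sum>i\<in>I. card (cell T ` (F \<inter> G i)))"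
        by (subst eq) (rule card_UN_le[OF I])
      then have "n T \<le> (\<Sum>i\<in>I. real (card (cell T ` (F \<inter> G i))))"
        unfolding n_def of_nat_sum[symmetric] by (rule of_nat_mono)
      then show "p T * n T \<le> (\<Sum>i\<in>I. p T * real (card (cell T ` (F \<inter> G i))))"
        unfolding sum_distrib_left[symmetric] by (rule mult_left_mono[OF _ p[OF T]])
    qed
    also have "\<dots> = (\<Sum>i\<in>I. \<Sum>T\<in>Pow P. p T * real (card (cell T ` (F \<inter> G i))))"
      by (rule sum.swap)
    also have "\<dots> \<le> (\<Sum>i\<in>I. exp L)"
      unfolding p_def
    proof (rule sum_mono)
      fix i assume i: "i \<in> I"
      have "(\<Sum>T\<in>Pow P. subset_prob w P T * real (card (cell T ` (F \<inter> G i)))) \<le>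
          exp (\<Sum>S\<in>{S\<in>P. cuts S (F \<inter> G i)}. w S)"
        by (rule expected_cells_le[OF P w])
      also have "\<dots> \<le> exp L"
        using L[OF i] by simp
      finally show "(\<Sum>T\<in>Pow P. subset_prob w P T * real (card (cell T ` (F \<inter> G i)))) \<le> exp L" .
    qed
    finally have mean: "(\<Sum>T\<in>Pow P. p T * n T) \<le> N"
      by (simp add: N_def)
    define s where "s = (cmod (\<Sum>a\<in>F. u a))\<^sup>2"
    have s: "s \<ge> 0"
      by (simp add: s_def)
    \<comment> \<open>Jensen's inequality for \<open>1 / n\<close>, by means of the tangent of \<open>1 / n\<close> at \<open>N\<close>\<close>
    have "s * (2 / N - n T / N\<^sup>2) \<le> R T" for T
    proof -
      have "2 / N - n T / N\<^sup>2 \<le> 1 / n T"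
      proof -
        have "1 / n T - (2 / N - n T / N\<^sup>2) = (N - n T)\<^sup>2 / (n T * N\<^sup>2)"
          using N n[of T] by (simp add: divide_simps) (simp add: power2_eq_square algebra_simps)
        moreover have "0 \<le> (N - n T)\<^sup>2 / (n T * N\<^sup>2)"
          using n[of T] by simp
        ultimately show ?thesis
          by linarith
      qed
      then have "s * (2 / N - n T / N\<^sup>2) \<le> s / n T"
        using mult_left_mono[OF _ s, of _ "1 / n T"] by simp
      also have "\<dots> \<le> R T"
        using total_le_partition_form[OF F, of u "cell T"] n[of T]
        by (simp add: pos_divide_le_eq s_def R_def n_def mult.commute)
      finally show ?thesis .
    qed
    then have "(\<Sum>T\<in>Pow P. p T * (s * (2 / N - n T / N\<^sup>2))) \<le> Re Q"
      unfolding Q using p by (intro sum_mono mult_left_mono) auto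
    also have "(\<Sum>T\<in>Pow P. p T * (s * (2 / N - n T / N\<^sup>2))) =
        (\<Sum>T\<in>Pow P. (s * (2 / N)) * p T - (s * (1 / N\<^sup>2)) * (p T * n T))"
      by (intro sum.cong refl) (simp add: right_diff_distrib mult_ac)
    also have "\<dots> = s * (2 / N * (\<Sum>T\<in>Pow P. p T) - (\<Sum>T\<in>Pow P. p T * n T) / N\<^sup>2)"
      by (simp only: sum_subtractf sum_distrib_left[symmetric]) (simp add: right_diff_distrib)
    also have "(\<Sum>T\<in>Pow P. p T) = 1"
      unfolding p_def by (rule sum_subset_prob[OF P])
    finally have "s * (2 / N * 1 - (\<Sum>T\<in>Pow P. p T * n T) / N\<^sup>2) \<le> Re Q" .
    moreover have "1 / N \<le> 2 / N * 1 - (\<Sum>T\<in>Pow P. p T * n T) / N\<^sup>2"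
    proof -
      have "(\<Sum>T\<in>Pow P. p T * n T) / N\<^sup>2 \<le> N / N\<^sup>2"
        using mean by (rule divide_right_mono) simp
      also have "N / N\<^sup>2 = 1 / N"
        using N by (simp add: power2_eq_square)
      finally show ?thesis
        by simp
    qed
    then have "s * (1 / N) \<le> s * (2 / N * 1 - (\<Sum>T\<in>Pow P. p T * n T) / N\<^sup>2)"
      by (rule mult_left_mono[OF _ s])
    ultimately have "s / N \<le> Re Q"
      by simp
    then show ?thesis
      using N by (simp add: pos_divide_le_eq s_def N_def mult_ac)
  qed
qed

section \<open>Cut decomposition of L1 metrics\<close>

text \<open>
  The length of the interval of thresholds \<open>p\<close> at which \<open>v\<close> cuts out \<open>S\<close>. For \<open>S = {}\<close> and \<open>S = F\<close> this interval
  is unbounded and the value is a default, but these \<open>S\<close> separate no points of \<open>F\<close>.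
\<close>

definition gap :: "'a set \<Rightarrow> ('a \<Rightarrow> real) \<Rightarrow> 'a set \<Rightarrow> real" where
  "gap F v S = measure lborel {p. {x \<in> F. v x \<le> p} = S}"

lemma level_set_borel:
  assumes "finite F"
  shows "{p::real. {x \<in> F. v x \<le> p} = S} \<in> sets lborel"
proof (cases "S \<subseteq> F")
  case True
  then have "{p. {x \<in> F. v x \<le> p} = S} = {p\<in>space lborel. \<forall>x\<in>F. v x \<le> p \<longleftrightarrow> x \<in> S}"
    by auto
  also have "\<dots> \<in> sets lborel"
    using assms by measurable
  finally show ?thesis .
next
  case False
  then have "{p. {x \<in> F. v x \<le> p} = S} = {}"
    by auto
  then show ?thesis
    by simp
qed

lemma sum_gap_le:
  assumes F: "finite F" and K: "finite K" and "lo \<le> hi"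
    and sub: "{p. {x \<in> F. v x \<le> p} \<in> K} \<subseteq> {lo..<hi}"
  shows "(\<Sum>S\<in>K. gap F v S) = measure lborel {p. {x \<in> F. v x \<le> p} \<in> K}"
    and "(\<Sum>S\<in>K. gap F v S) \<le> hi - lo"
proof -
  let ?D = "\<lambda>S. {p. {x \<in> F. v x \<le> p} = S}"
  have fin: "emeasure lborel (?D S) \<noteq> \<infinity>" if "S \<in> K" for S
  proof -
    have "emeasure lborel (?D S) \<le> emeasure lborel {lo..<hi}"
      using sub that by (intro emeasure_mono) auto
    then show ?thesis
      using \<open>lo \<le> hi\<close> by (auto simp: top_unique)
  qed
  have U: "{p. {x \<in> F. v x \<le> p} \<in> K} = (\<Union>S\<in>K. ?D S)"
    by auto
  have meas: "{p. {x \<in> F. v x \<le> p} \<in> K} \<in> sets lborel"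
    unfolding U by (intro sets.finite_UN K level_set_borel F)
  show eq: "(\<Sum>S\<in>K. gap F v S) = measure lborel {p. {x \<in> F. v x \<le> p} \<in> K}"
    unfolding U gap_def using fin
    by (intro measure_finite_Union[symmetric] K)
       (auto simp: disjoint_family_on_def intro: level_set_borel[OF F, unfolded sets_lborel])
  have "measure lborel {p. {x \<in> F. v x \<le> p} \<in> K} \<le> measure lborel {lo..<hi}"
    using sub \<open>lo \<le> hi\<close> meas by (intro measure_mono_fmeasurable) (auto simp: fmeasurable_def)
  then show "(\<Sum>S\<in>K. gap F v S) \<le> hi - lo"
    using eq \<open>lo \<le> hi\<close> by simp
qed

text \<open>
  A threshold separates \<open>a\<close> from \<open>b\<close> exactly if it lies between \<open>v a\<close> and \<open>v b\<close>.
\<close>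

lemma abs_diff_eq_sum_gap:
  assumes F: "finite F" and ab: "a \<in> F" "b \<in> F"
  shows "\<bar>v a - v b\<bar> = (\<Sum>S\<in>{S\<in>Pow F. separates S a b}. gap F v S)"
proof -
  have eq: "{p. {x \<in> F. v x \<le> p} \<in> {S\<in>Pow F. separates S a b}} = {min (v a) (v b)..<max (v a) (v b)}"
    using ab by (auto simp: separates_def)
  have "(\<Sum>S\<in>{S\<in>Pow F. separates S a b}. gap F v S) = measure lborel {min (v a) (v b)..<max (v a) (v b)}"
    using sum_gap_le(1)[OF F _ _ equalityD1[OF eq]] F unfolding eq by simp
  then show ?thesis
    by (simp add: max_def min_def)
qed

lemma sum_gap_cuts_le:
  assumes F: "finite F" and G: "G \<subseteq> F" and osc: "\<And>a b. a \<in> G \<Longrightarrow> b \<in> G \<Longrightarrow> \<bar>v a - v b\<bar> \<le> r"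
    and "0 \<le> r"
  shows "(\<Sum>S\<in>{S\<in>Pow F. cuts S G}. gap F v S) \<le> r"
proof (cases "G = {}")
  case True
  then show ?thesis
    using \<open>0 \<le> r\<close> by (simp add: cuts_def)
next
  case False
  have finG: "finite (v ` G)" "v ` G \<noteq> {}"
    using F G finite_subset False by auto
  obtain a b where ab: "a \<in> G" "b \<in> G" "v a = Min (v ` G)" "v b = Max (v ` G)"
    using Min_in[OF finG] Max_in[OF finG] by auto
  have bounds: "v a \<le> v x" "v x \<le> v b" if "x \<in> G" for x
    using that finG ab by auto
  have "(\<Sum>S\<in>{S\<in>Pow F. cuts S G}. gap F v S) \<le> v b - v a"
  proof (rule sum_gap_le(2)[OF F])
    show "{p. {x \<in> F. v x \<le> p} \<in> {S\<in>Pow F. cuts S G}} \<subseteq> {v a..<v b}"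
    proof
      fix p assume "p \<in> {p. {x \<in> F. v x \<le> p} \<in> {S\<in>Pow F. cuts S G}}"
      then obtain x y where "x \<in> G" "y \<in> G" "separates {x \<in> F. v x \<le> p} x y"
        unfolding cuts_def by blast
      then obtain x y where "x \<in> G" "y \<in> G" "v x \<le> p" "p < v y"
        using G unfolding separates_def by (cases "v x \<le> p") force+
      then show "p \<in> {v a..<v b}"
        using bounds(1)[of x] bounds(2)[of y] by auto
    qed
    show "v a \<le> v b"
      by (rule bounds(2)[OF ab(1)])
  qed (use F in simp)
  also have "\<dots> \<le> r"
    using osc[OF ab(2,1)] by simp
  finally show ?thesis .
qed

lemma gap_measurable:
  assumes F: "finite F" and f: "\<And>x. x \<in> F \<Longrightarrow> f x \<in> borel_measurable M"
  shows "(\<lambda>\<omega>. gap F (\<lambda>x. f x \<omega>) S) \<in> borel_measurable M"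
proof (cases "S \<subseteq> F")
  case True
  let ?Q = "{z \<in> space (M \<Otimes>\<^sub>M lborel). \<forall>x\<in>F. f x (fst z) \<le> snd z \<longleftrightarrow> x \<in> S}"
  have [measurable]: "(\<lambda>z. f x (fst z)) \<in> borel_measurable (M \<Otimes>\<^sub>M lborel)" if "x \<in> F" for x
    using f[OF that] by measurable
  have Q: "?Q \<in> sets (M \<Otimes>\<^sub>M lborel)"
    using F by measurable
  have "gap F (\<lambda>x. f x \<omega>) S = enn2real (emeasure lborel (Pair \<omega> -` ?Q))" if "\<omega> \<in> space M" for \<omega>
  proof -
    have "{p. {x \<in> F. f x \<omega> \<le> p} = S} = Pair \<omega> -` ?Q"
      using that True by (auto simp: space_pair_measure)
    then show ?thesis
      by (simp add: gap_def measure_def)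
  qed
  moreover have "(\<lambda>\<omega>. enn2real (emeasure lborel (Pair \<omega> -` ?Q))) \<in> borel_measurable M"
    using lborel.measurable_emeasure_Pair[OF Q] by measurable
  ultimately show ?thesis
    by (subst measurable_cong) auto
next
  case False
  then have "{p. {x \<in> F. f x \<omega> \<le> p} = S} = {}" for \<omega>
    by auto
  then show ?thesis
    by (simp add: gap_def)
qed

text \<open>
  The weight of \<open>S\<close> is the mean of its gap. The last clause controls the total weight of the cuts dividing a
  set by the mean oscillation of \<open>f\<close> on it; for Euclidean balls this gives the bound on the
  expected number of cells.
\<close>

theorem L1_metric_cut_decomposition:
  fixes f :: "'a \<Rightarrow> 'w \<Rightarrow> real"
  assumes F: "finite F" and f: "\<And>x. x \<in> F \<Longrightarrow> integrable M (f x)"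
  obtains w where "\<And>S. 0 \<le> w S"
    and "\<And>a b. a \<in> F \<Longrightarrow> b \<in> F \<Longrightarrow>
      (LINT \<omega>|M. \<bar>f a \<omega> - f b \<omega>\<bar>) = (\<Sum>S\<in>Pow F. if separates S a b then w S else 0)"
    and "\<And>G g. \<lbrakk>G \<subseteq> F; integrable M g; \<And>\<omega>. 0 \<le> g \<omega>;
      \<And>a b \<omega>. a \<in> G \<Longrightarrow> b \<in> G \<Longrightarrow> \<bar>f a \<omega> - f b \<omega>\<bar> \<le> g \<omega>\<rbrakk>
      \<Longrightarrow> (\<Sum>S\<in>{S\<in>Pow F. cuts S G}. w S) \<le> (LINT \<omega>|M. g \<omega>)"
proof -
  let ?h = "\<lambda>S \<omega>. gap F (\<lambda>x. f x \<omega>) S"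
  define w where "w S = (LINT \<omega>|M. ?h S \<omega>)" for S
  have gap_nonneg: "0 \<le> ?h S \<omega>" for S \<omega>
    by (simp add: gap_def)
  have gap_integrable: "integrable M (?h S)" if S: "S \<in> Pow F" "cuts S F" for S
  proof -
    obtain a b where ab: "a \<in> F" "b \<in> F" "separates S a b"
      using S by (auto simp: cuts_def)
    show ?thesis
    proof (rule Bochner_Integration.integrable_bound)
      show "integrable M (\<lambda>\<omega>. f a \<omega> - f b \<omega>)"
        using f ab by auto
      show "?h S \<in> borel_measurable M"
        using f by (intro gap_measurable F borel_measurable_integrable)
      have "?h S \<omega> \<le> \<bar>f a \<omega> - f b \<omega>\<bar>" for \<omega>
        unfolding abs_diff_eq_sum_gap[OF F ab(1,2), of "\<lambda>x. f x \<omega>"]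
        by (rule member_le_sum) (use S ab F gap_nonneg in auto)
      then show "AE \<omega> in M. norm (?h S \<omega>) \<le> norm (f a \<omega> - f b \<omega>)"
        using gap_nonneg by auto
    qed
  qed
  show ?thesis
  proof (rule that[of w])
    show "0 \<le> w S" for S
      unfolding w_def by (intro integral_nonneg_AE) (simp add: gap_nonneg)
    show "(LINT \<omega>|M. \<bar>f a \<omega> - f b \<omega>\<bar>) = (\<Sum>S\<in>Pow F. if separates S a b then w S else 0)"
      if ab: "a \<in> F" "b \<in> F" for a b
    proof -
      have "(LINT \<omega>|M. \<bar>f a \<omega> - f b \<omega>\<bar>) = (LINT \<omega>|M. (\<Sum>S\<in>{S\<in>Pow F. separates S a b}. ?h S \<omega>))"
        by (subst abs_diff_eq_sum_gap[OF F ab, of "\<lambda>x. f x _"]) (rule refl)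
      also have "\<dots> = (\<Sum>S\<in>{S\<in>Pow F. separates S a b}. w S)"
        unfolding w_def using ab
        by (intro Bochner_Integration.integral_sum gap_integrable) (auto simp: cuts_def)
      also have "\<dots> = (\<Sum>S\<in>Pow F. if separates S a b then w S else 0)"
        using F by (intro sum.inter_filter) simp
      finally show ?thesis .
    qed
    show "(\<Sum>S\<in>{S\<in>Pow F. cuts S G}. w S) \<le> (LINT \<omega>|M. g \<omega>)"
      if G: "G \<subseteq> F" and g: "integrable M g" "\<And>\<omega>. 0 \<le> g \<omega>"
        and osc: "\<And>a b \<omega>. a \<in> G \<Longrightarrow> b \<in> G \<Longrightarrow> \<bar>f a \<omega> - f b \<omega>\<bar> \<le> g \<omega>" for G g
    proof -
      have int: "integrable M (?h S)" if "S \<in> {S\<in>Pow F. cuts S G}" for S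
        using that G by (intro gap_integrable) (auto simp: cuts_def)
      have "(\<Sum>S\<in>{S\<in>Pow F. cuts S G}. w S) = (LINT \<omega>|M. (\<Sum>S\<in>{S\<in>Pow F. cuts S G}. ?h S \<omega>))"
        unfolding w_def using int by (simp add: Bochner_Integration.integral_sum)
      also have "\<dots> \<le> (LINT \<omega>|M. g \<omega>)"
        using int g by (intro integral_mono Bochner_Integration.integrable_sum sum_gap_cuts_le F G osc) auto
      finally show ?thesis .
    qed
  qed
qed

section \<open>The Euclidean norm as a mean of Gaussian projections\<close>

text \<open>
  Coordinates are indexed by the standard basis, so that the construction works in every Euclidean
  space.
\<close>

definition gaussian_measure :: "('a::euclidean_space \<Rightarrow> real) measure" where
  "gaussian_measure = PiM Basis (\<lambda>_. density lborel (\<lambda>x. ennreal (std_normal_density x)))"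

definition gaussian_proj :: "'a::euclidean_space \<Rightarrow> ('a \<Rightarrow> real) \<Rightarrow> real" where
  "gaussian_proj x \<omega> = (\<Sum>b\<in>Basis. (x \<bullet> b) * \<omega> b)"

lemma prob_space_std_normal: "prob_space (density lborel (\<lambda>x. ennreal (std_normal_density x)))"
  by (rule prob_space_normal_density) simp

lemma prob_space_gaussian: "prob_space gaussian_measure"
  unfolding gaussian_measure_def by (intro prob_space_PiM prob_space_std_normal)

lemma measurable_gaussian_component [measurable]:
  "b \<in> Basis \<Longrightarrow> (\<lambda>\<omega>. \<omega> b) \<in> borel_measurable gaussian_measure"
  unfolding gaussian_measure_def by (rule measurable_PiM_component_rev) auto

lemma gaussian_component_distributed:
  fixes b :: "'a::euclidean_space"
  assumes "b \<in> Basis"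
  shows "distributed gaussian_measure lborel (\<lambda>\<omega>. \<omega> b) std_normal_density"
proof -
  let ?N = "density lborel (\<lambda>x. ennreal (std_normal_density x))"
  have "distr gaussian_measure lborel (\<lambda>\<omega>. \<omega> b) = distr gaussian_measure ?N (\<lambda>\<omega>. \<omega> b)"
    by (intro distr_cong) auto
  also have "\<dots> = ?N"
    unfolding gaussian_measure_def using assms by (intro distr_PiM_component prob_space_std_normal)
  finally show ?thesis
    using assms by (simp add: distributed_def)
qed

lemma gaussian_components_indep:
  "prob_space.indep_vars (gaussian_measure :: ('a::euclidean_space \<Rightarrow> real) measure)
     (\<lambda>_. borel) (\<lambda>b \<omega>. \<omega> b) Basis"
proof -
  let ?N = "density lborel (\<lambda>x. ennreal (std_normal_density x))"
  interpret prob_space "gaussian_measure :: ('a \<Rightarrow> real) measure"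
    by (rule prob_space_gaussian)
  have "distr gaussian_measure (PiM Basis (\<lambda>_. borel)) (\<lambda>\<omega>. \<lambda>b\<in>Basis. \<omega> b) =
      distr gaussian_measure (gaussian_measure :: ('a \<Rightarrow> real) measure) (\<lambda>\<omega>. \<omega>)"
  proof (rule distr_cong)
    show "sets (PiM Basis (\<lambda>_. borel)) = sets (gaussian_measure :: ('a \<Rightarrow> real) measure)"
      unfolding gaussian_measure_def by (intro sets_PiM_cong) auto
    show "(\<lambda>b\<in>Basis. \<omega> b) = \<omega>" if "\<omega> \<in> space gaussian_measure" for \<omega> :: "'a \<Rightarrow> real"
      using that by (auto simp: gaussian_measure_def space_PiM PiE_def extensional_restrict)
  qed simp
  also have "\<dots> = PiM Basis (\<lambda>b. distr gaussian_measure borel (\<lambda>\<omega>. \<omega> b))"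
  proof -
    have "distr gaussian_measure borel (\<lambda>\<omega>. \<omega> b) = ?N" if "b \<in> Basis" for b :: 'a
    proof -
      have "distr gaussian_measure borel (\<lambda>\<omega>. \<omega> b) = distr gaussian_measure ?N (\<lambda>\<omega>. \<omega> b)"
        by (intro distr_cong) auto
      also have "\<dots> = ?N"
        unfolding gaussian_measure_def using that by (intro distr_PiM_component prob_space_std_normal)
      finally show ?thesis .
    qed
    then show ?thesis
      unfolding distr_id by (subst gaussian_measure_def) (intro PiM_cong, auto)
  qed
  finally show ?thesis
    by (subst indep_vars_iff_distr_eq_PiM') auto
qed

text \<open>
  This is the rotation invariance of the Gaussian measure in the form needed: a sum of independent
  centred normal variables is normal, and the variances add up to \<open>|x|\<^sup>2\<close>.
\<close>

lemma gaussian_proj_distributed: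
  fixes x :: "'a::euclidean_space"
  assumes "x \<noteq> 0"
  shows "distributed gaussian_measure lborel (gaussian_proj x) (normal_density 0 (norm x))"
proof -
  interpret prob_space "gaussian_measure :: ('a \<Rightarrow> real) measure"
    by (rule prob_space_gaussian)
  \<comment> \<open>coordinates that vanish on \<open>x\<close> contribute a constant, which has no normal density\<close>
  define I where "I = {b\<in>Basis. x \<bullet> b \<noteq> 0}"
  have I: "finite I" "I \<noteq> {}" "I \<subseteq> Basis"
    using assms euclidean_all_zero_iff[of x] by (auto simp: I_def)
  have indep: "indep_vars (\<lambda>_. borel) (\<lambda>b \<omega>. (x \<bullet> b) * \<omega> b) I"
    by (rule indep_vars_compose2[OF indep_vars_subset[OF gaussian_components_indep I(3)]]) auto
  have "distributed gaussian_measure lborel (\<lambda>\<omega>. \<Sum>b\<in>I. (x \<bullet> b) * \<omega> b)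
      (normal_density (\<Sum>b\<in>I. 0) (sqrt (\<Sum>b\<in>I. \<bar>x \<bullet> b\<bar>\<^sup>2)))"
  proof (rule sum_indep_normal[OF I(1,2) indep])
    fix b assume b: "b \<in> I"
    then show "0 < \<bar>x \<bullet> b\<bar>"
      by (simp add: I_def)
    show "distributed gaussian_measure lborel (\<lambda>\<omega>. (x \<bullet> b) * \<omega> b) (normal_density 0 \<bar>x \<bullet> b\<bar>)"
      using normal_density_affine[OF gaussian_component_distributed, of b "x \<bullet> b" 0] b by (simp add: I_def)
  qed
  moreover have "(\<Sum>b\<in>I. (x \<bullet> b) * \<omega> b) = gaussian_proj x \<omega>" for \<omega>
    unfolding gaussian_proj_def I_def by (rule sum.mono_neutral_left) auto
  moreover have "(\<Sum>b\<in>I. \<bar>x \<bullet> b\<bar>\<^sup>2) = (\<Sum>b\<in>Basis. (x \<bullet> b)\<^sup>2)"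
    unfolding I_def power2_abs by (rule sum.mono_neutral_left) auto
  then have "sqrt (\<Sum>b\<in>I. \<bar>x \<bullet> b\<bar>\<^sup>2) = norm x"
    by (simp add: norm_eq_sqrt_inner[of x] euclidean_inner[of x x] power2_eq_square)
  ultimately show ?thesis
    by simp
qed

lemma gaussian_proj_abs:
  fixes x :: "'a::euclidean_space"
  shows "integrable gaussian_measure (gaussian_proj x)"
    and "(LINT \<omega>|gaussian_measure. \<bar>gaussian_proj x \<omega>\<bar>) = norm x * sqrt (2 / pi)"
proof -
  have "integrable gaussian_measure (gaussian_proj x) \<and>
      (LINT \<omega>|gaussian_measure. \<bar>gaussian_proj x \<omega>\<bar>) = norm x * sqrt (2 / pi)"
  proof (cases "x = 0")
    case True
    then have "gaussian_proj x = (\<lambda>_. 0)"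
      by (auto simp: gaussian_proj_def)
    then show ?thesis
      using True by simp
  next
    case False
    note D = gaussian_proj_distributed[OF False]
    have m: "has_bochner_integral lborel (\<lambda>y. normal_density 0 (norm x) y * \<bar>y\<bar>) (norm x * sqrt (2 / pi))"
      using normal_moment_abs_odd[of "norm x" 0 0] False by simp
    have "integrable gaussian_measure (\<lambda>\<omega>. \<bar>gaussian_proj x \<omega>\<bar>)"
      using m by (subst distributed_integrable[OF D, symmetric]) (auto simp: has_bochner_integral_iff)
    then have "integrable gaussian_measure (gaussian_proj x)"
      by (rule integrable_abs_cancel) (use distributed_measurable[OF D] in simp)
    moreover have "(LINT \<omega>|gaussian_measure. \<bar>gaussian_proj x \<omega>\<bar>) = norm x * sqrt (2 / pi)"
      using m by (subst distributed_integral[OF D, symmetric]) (auto simp: has_bochner_integral_iff)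
    ultimately show ?thesis
      by blast
  qed
  then show "integrable gaussian_measure (gaussian_proj x)"
    and "(LINT \<omega>|gaussian_measure. \<bar>gaussian_proj x \<omega>\<bar>) = norm x * sqrt (2 / pi)"
    by auto
qed

lemma gaussian_proj_diff: "gaussian_proj x \<omega> - gaussian_proj y \<omega> = gaussian_proj (x - y) \<omega>"
  by (simp add: gaussian_proj_def inner_diff_left left_diff_distrib sum_subtractf)

lemma gaussian_proj_Basis: "b \<in> Basis \<Longrightarrow> gaussian_proj b \<omega> = \<omega> b"
  by (simp add: gaussian_proj_def inner_Basis if_distrib[of "\<lambda>x. x * _"] sum.delta cong: if_cong)

lemma gaussian_l1:
  fixes \<omega> :: "'a::euclidean_space \<Rightarrow> real"
  defines "L1 \<equiv> (\<lambda>\<omega>::'a \<Rightarrow> real. \<Sum>b\<in>Basis. \<bar>\<omega> b\<bar>)"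
  shows "integrable gaussian_measure L1"
    and "(LINT \<omega>|gaussian_measure. L1 \<omega>) = DIM('a) * sqrt (2 / pi)"
    and "\<bar>gaussian_proj x \<omega>\<bar> \<le> norm x * L1 \<omega>"
proof -
  have "integrable gaussian_measure (\<lambda>\<omega>. \<bar>\<omega> b\<bar>)"
    and "(LINT \<omega>|gaussian_measure. \<bar>\<omega> b\<bar>) = sqrt (2 / pi)" if "b \<in> Basis" for b :: 'a
  proof -
    have "gaussian_proj b = (\<lambda>\<omega>. \<omega> b)"
      using that by (intro ext gaussian_proj_Basis)
    then show "integrable gaussian_measure (\<lambda>\<omega>. \<bar>\<omega> b\<bar>)"
      and "(LINT \<omega>|gaussian_measure. \<bar>\<omega> b\<bar>) = sqrt (2 / pi)"
      using gaussian_proj_abs[of b] that by auto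
  qed
  then show "integrable gaussian_measure L1"
    and "(LINT \<omega>|gaussian_measure. L1 \<omega>) = DIM('a) * sqrt (2 / pi)"
    unfolding L1_def by (auto simp: Bochner_Integration.integral_sum)
  have "\<bar>gaussian_proj x \<omega>\<bar> \<le> (\<Sum>b\<in>Basis. \<bar>x \<bullet> b\<bar> * \<bar>\<omega> b\<bar>)"
    unfolding gaussian_proj_def by (rule order_trans[OF sum_abs]) (simp add: abs_mult)
  also have "\<dots> \<le> (\<Sum>b\<in>Basis. norm x * \<bar>\<omega> b\<bar>)"
    by (intro sum_mono mult_right_mono Basis_le_norm) auto
  finally show "\<bar>gaussian_proj x \<omega>\<bar> \<le> norm x * L1 \<omega>"
    by (simp add: L1_def sum_distrib_left)
qed

section \<open>Covering and packing\<close>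

definition separated :: "real \<Rightarrow> 'a::metric_space set \<Rightarrow> bool" where
  "separated \<epsilon> S \<longleftrightarrow> (\<forall>a\<in>S. \<forall>b\<in>S. a \<noteq> b \<longrightarrow> \<epsilon> < dist a b)"

lemma compact_finite_cover:
  assumes "compact A" "\<epsilon> > 0"
  obtains S where "finite S" "S \<subseteq> A" "A \<subseteq> (\<Union>x\<in>S. cball x \<epsilon>)"
proof -
  obtain S where S: "S \<subseteq> A" "finite S" "A \<subseteq> (\<Union>x\<in>S. ball x \<epsilon>)"
    by (rule compactE_image[OF assms(1), of A "\<lambda>x. ball x \<epsilon>"]) (use assms(2) in auto)
  then show ?thesis
    by (intro that[of S] subset_trans[OF S(3)]) auto
qed

lemma covering_number_attained:
  assumes "compact A" "\<epsilon> > 0"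
  obtains S where "finite S" "S \<subseteq> A" "card S = covering_number A \<epsilon>" "A \<subseteq> (\<Union>x\<in>S. cball x \<epsilon>)"
proof -
  let ?P = "\<lambda>k. \<exists>S. finite S \<and> S \<subseteq> A \<and> card S = k \<and> A \<subseteq> (\<Union>x\<in>S. cball x \<epsilon>)"
  obtain S where "finite S" "S \<subseteq> A" "A \<subseteq> (\<Union>x\<in>S. cball x \<epsilon>)"
    by (rule compact_finite_cover[OF assms])
  then have "?P (card S)"
    by blast
  then have "?P (LEAST k. ?P k)"
    by (rule LeastI)
  then show ?thesis
    using that unfolding covering_number_def by blast
qed

lemma covering_number_le_card:
  "\<lbrakk>finite S; S \<subseteq> A; A \<subseteq> (\<Union>x\<in>S. cball x \<epsilon>)\<rbrakk> \<Longrightarrow> covering_number A \<epsilon> \<le> card S"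
  unfolding covering_number_def by (rule Least_le) blast

lemma covering_number_pos:
  assumes "compact A" "A \<noteq> {}" "\<epsilon> > 0"
  shows "covering_number A \<epsilon> > 0"
proof -
  obtain S where "finite S" "card S = covering_number A \<epsilon>" "A \<subseteq> (\<Union>x\<in>S. cball x \<epsilon>)"
    by (rule covering_number_attained[OF assms(1,3)])
  with assms(2) show ?thesis
    by (metis card_gt_0_iff UN_empty subset_empty)
qed

text \<open>
  A separated set of maximal cardinality covers \<open>A\<close>. Cardinalities are bounded because a ball of radius
  \<open>\<epsilon> / 2\<close> contains at most one of the points.
\<close>

lemma separated_net_exists:
  assumes "compact A" "\<epsilon> > 0"
  obtains S where "finite S" "S \<subseteq> A" "separated \<epsilon> S" "covering_number A \<epsilon> \<le> card S"
proof -
  obtain C where C: "finite C" "A \<subseteq> (\<Union>x\<in>C. cball x (\<epsilon> / 2))"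
    by (rule compact_finite_cover[OF assms(1), of "\<epsilon> / 2"]) (use assms(2) in simp)
  let ?P = "\<lambda>S. finite S \<and> S \<subseteq> A \<and> separated \<epsilon> S"
  have "card S \<le> card C" if S: "?P S" for S
  proof -
    have "\<exists>c\<in>C. dist c x \<le> \<epsilon> / 2" if "x \<in> S" for x
      using S C(2) that unfolding mem_cball[symmetric] by blast
    then have "\<exists>c. \<forall>x\<in>S. c x \<in> C \<and> dist (c x) x \<le> \<epsilon> / 2"
      by (intro bchoice) blast
    then obtain c where c: "\<And>x. x \<in> S \<Longrightarrow> c x \<in> C" "\<And>x. x \<in> S \<Longrightarrow> dist (c x) x \<le> \<epsilon> / 2"
      by blast
    have "inj_on c S"
    proof (rule inj_onI, rule ccontr)
      fix x y assume xy: "x \<in> S" "y \<in> S" "c x = c y" "x \<noteq> y"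
      have "\<epsilon> < dist x y"
        using S xy by (auto simp: separated_def)
      moreover have "dist x y \<le> dist (c x) x + dist (c x) y"
        by (rule dist_triangle3)
      ultimately show False
        using c(2)[OF xy(1)] c(2)[OF xy(2)] xy(3) by simp
    qed
    then show ?thesis
      using c(1) C(1) by (intro card_inj_on_le[of c]) auto
  qed
  then have bound: "\<forall>S. ?P S \<longrightarrow> card S < Suc (card C)"
    by (meson le_imp_less_Suc)
  have "?P {}"
    by (simp add: separated_def)
  from ex_has_greatest_nat[of ?P, OF this bound]
  obtain S where S: "?P S" and max: "\<And>S'. ?P S' \<Longrightarrow> card S' \<le> card S"
    by blast
  have "A \<subseteq> (\<Union>x\<in>S. cball x \<epsilon>)"
  proof (rule ccontr)
    assume "\<not> A \<subseteq> (\<Union>x\<in>S. cball x \<epsilon>)"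
    then obtain y where "y \<in> A" "\<forall>x\<in>S. y \<notin> cball x \<epsilon>"
      by blast
    then have y: "y \<in> A" "\<And>x. x \<in> S \<Longrightarrow> \<epsilon> < dist x y"
      by (auto simp: not_le)
    have "separated \<epsilon> (insert y S)"
      unfolding separated_def
    proof (intro ballI impI)
      fix a b assume ab: "a \<in> insert y S" "b \<in> insert y S" "a \<noteq> b"
      consider "a = y" "b \<in> S" | "b = y" "a \<in> S" | "a \<in> S" "b \<in> S"
        using ab by blast
      then show "\<epsilon> < dist a b"
        by cases (use S y(2) ab(3) in \<open>auto simp: separated_def dist_commute[of y]\<close>)
    qed
    then have "?P (insert y S)"
      using S y(1) by blast
    moreover have "y \<notin> S"
      using y(2)[of y] assms(2) by auto
    ultimately show False
      using max[of "insert y S"] S card_insert_disjoint[of S y] by simp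
  qed
  then show ?thesis
    using S that covering_number_le_card by blast
qed

text \<open>
  The disjoint balls of radius \<open>\<epsilon> / 2\<close> around the points of \<open>S\<close> lie in a ball of radius \<open>(k + 1 / 2) \<epsilon>\<close>.
\<close>

lemma separated_card_le:
  fixes S :: "'a::euclidean_space set"
  assumes fin: "finite S" and sep: "separated \<epsilon> S" and \<epsilon>: "\<epsilon> > 0"
    and near: "\<And>b. b \<in> S \<Longrightarrow> dist a b \<le> real k * \<epsilon>"
  shows "real (card S) \<le> (2 * real k + 1) ^ DIM('a)"
proof -
  define V where "V = unit_ball_vol (real DIM('a))"
  have V: "V > 0"
    by (simp add: V_def)
  have disj: "disjoint_family_on (\<lambda>b. ball b (\<epsilon> / 2)) S"
    unfolding disjoint_family_on_def
  proof (intro ballI impI, rule ccontr)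
    fix x y assume xy: "x \<in> S" "y \<in> S" "x \<noteq> y" "ball x (\<epsilon> / 2) \<inter> ball y (\<epsilon> / 2) \<noteq> {}"
    then obtain z where "dist x z < \<epsilon> / 2" "dist y z < \<epsilon> / 2"
      by auto
    then have "dist x y < \<epsilon>"
      using dist_triangle2[of x y z] by simp
    moreover have "\<epsilon> < dist x y"
      using sep xy by (auto simp: separated_def)
    ultimately show False
      by simp
  qed
  have "real (card S) * (V * (\<epsilon> / 2) ^ DIM('a)) = (\<Sum>b\<in>S. measure lborel (ball b (\<epsilon> / 2)))"
    using \<epsilon> by (simp add: content_ball V_def)
  also have "\<dots> = measure lborel (\<Union>b\<in>S. ball b (\<epsilon> / 2))"
    using fin disj emeasure_bounded_finite[of "ball _ (\<epsilon> / 2)"]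
    by (intro measure_finite_Union[symmetric]) (auto simp: less_top[symmetric])
  also have "\<dots> \<le> measure lborel (ball a ((2 * real k + 1) * (\<epsilon> / 2)))"
  proof (rule measure_mono_fmeasurable)
    show "(\<Union>b\<in>S. ball b (\<epsilon> / 2)) \<subseteq> ball a ((2 * real k + 1) * (\<epsilon> / 2))"
    proof clarify
      fix b x assume "b \<in> S" "x \<in> ball b (\<epsilon> / 2)"
      then show "x \<in> ball a ((2 * real k + 1) * (\<epsilon> / 2))"
        using near[of b] dist_triangle[of a x b] by (simp add: algebra_simps)
    qed
  qed (use fin in \<open>auto intro!: fmeasurableI emeasure_bounded_finite\<close>)
  also have "\<dots> = (2 * real k + 1) ^ DIM('a) * (V * (\<epsilon> / 2) ^ DIM('a))"
  proof -
    have "measure lborel (ball a ((2 * real k + 1) * (\<epsilon> / 2))) = V * ((2 * real k + 1) * (\<epsilon> / 2)) ^ DIM('a)"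
      using \<epsilon> content_ball[of "(2 * real k + 1) * (\<epsilon> / 2)" a] by (simp add: V_def)
    then show ?thesis
      unfolding power_mult_distrib[of _ "\<epsilon> / 2"] by (simp only: mult_ac)
  qed
  finally show ?thesis
    using V \<epsilon> by (simp add: mult_le_cancel_right)
qed

definition packing_const :: "nat \<Rightarrow> real" where
  "packing_const n = suminf (\<lambda>k. (2 * real k + 1) ^ n * exp (1 - real k))"

lemma summable_packing: "summable (\<lambda>k. (2 * real k + 1) ^ n * exp (1 - real k))"
proof (rule summable_comparison_test_bigo)
  show "summable (\<lambda>k. norm (exp (- 1 / 2 :: real) ^ k))"
    by (simp add: summable_geometric)
  show "(\<lambda>k. (2 * real k + 1) ^ n * exp (1 - real k)) \<in> O(\<lambda>k. exp (- 1 / 2) ^ k)"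
    unfolding exp_of_nat_mult[symmetric] by real_asymp
qed

lemma packing_const_pos: "0 < packing_const n"
  unfolding packing_const_def by (rule suminf_pos[OF summable_packing]) (auto intro: mult_pos_pos zero_less_power)

text \<open>
  Group the points by their distance from \<open>a\<close>, rounded up to a multiple \<open>k\<close> of \<open>\<epsilon>\<close>: there are at most
  \<open>(2 k + 1) ^ n\<close> points in each group, and each contributes at most \<open>exp (1 - k)\<close>.
\<close>

lemma separated_exp_sum_le:
  fixes S :: "'a::euclidean_space set"
  assumes fin: "finite S" and sep: "separated \<epsilon> S" and \<epsilon>: "\<epsilon> > 0"
  shows "(\<Sum>b\<in>S. exp (- (dist a b / \<epsilon>))) \<le> packing_const DIM('a)"
proof -
  define g where "g b = nat \<lceil>dist a b / \<epsilon>\<rceil>" for b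
  have g: "dist a b / \<epsilon> \<le> real (g b)" "real (g b) \<le> dist a b / \<epsilon> + 1" for b
  proof -
    have "0 \<le> dist a b / \<epsilon>"
      using \<epsilon> by simp
    then show "dist a b / \<epsilon> \<le> real (g b)" "real (g b) \<le> dist a b / \<epsilon> + 1"
      unfolding g_def by linarith+
  qed
  have "(\<Sum>b\<in>S. exp (- (dist a b / \<epsilon>))) \<le> (\<Sum>b\<in>S. exp (1 - real (g b)))"
  proof (rule sum_mono)
    show "exp (- (dist a b / \<epsilon>)) \<le> exp (1 - real (g b))" for b
      using g(2)[of b] by simp
  qed
  also have "\<dots> = (\<Sum>k\<in>g ` S. \<Sum>b\<in>{b\<in>S. g b = k}. exp (1 - real (g b)))"
    by (rule sum.image_gen[OF fin])
  also have "\<dots> = (\<Sum>k\<in>g ` S. real (card {b\<in>S. g b = k}) * exp (1 - real k))"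
    by (intro sum.cong refl) simp
  also have "\<dots> \<le> (\<Sum>k\<in>g ` S. (2 * real k + 1) ^ DIM('a) * exp (1 - real k))"
  proof (intro sum_mono mult_right_mono separated_card_le[of _ \<epsilon> a])
    show "dist a b \<le> real k * \<epsilon>" if "b \<in> {b\<in>S. g b = k}" for b k
      using that g(1)[of b] \<epsilon> by (simp add: pos_divide_le_eq)
  qed (use fin sep \<epsilon> in \<open>auto simp: separated_def\<close>)
  also have "\<dots> \<le> packing_const DIM('a)"
    unfolding packing_const_def using fin by (intro sum_le_suminf summable_packing) auto
  finally show ?thesis .
qed

section \<open>Upper and lower limits of logarithmic growth rates\<close>

lemma Limsup_Liminf_le_of_vanishing_excess:
  fixes u v r :: "'b \<Rightarrow> real"
  assumes F: "F \<noteq> bot" and r: "(r \<longlongrightarrow> 0) F" and le: "eventually (\<lambda>x. u x \<le> v x + r x) F"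
  shows "Limsup F (\<lambda>x. ereal (u x)) \<le> Limsup F (\<lambda>x. ereal (v x))"
    and "Liminf F (\<lambda>x. ereal (u x)) \<le> Liminf F (\<lambda>x. ereal (v x))"
proof -
  have ev: "eventually (\<lambda>x. ereal (u x) \<le> ereal (v x) + ereal e) F" if "e > 0" for e
    using order_tendstoD(2)[OF r that] le by eventually_elim simp
  show "Limsup F (\<lambda>x. ereal (u x)) \<le> Limsup F (\<lambda>x. ereal (v x))"
  proof (rule ereal_le_epsilon2)
    fix e :: real assume "0 < e"
    then have "Limsup F (\<lambda>x. ereal (u x)) \<le> Limsup F (\<lambda>x. ereal (v x) + ereal e)"
      by (intro Limsup_mono ev)
    also have "\<dots> = Limsup F (\<lambda>x. ereal (v x)) + ereal e"
      by (rule Limsup_add_ereal_right[OF F]) simp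
    finally show "Limsup F (\<lambda>x. ereal (u x)) \<le> Limsup F (\<lambda>x. ereal (v x)) + ereal e" .
  qed
  show "Liminf F (\<lambda>x. ereal (u x)) \<le> Liminf F (\<lambda>x. ereal (v x))"
  proof (rule ereal_le_epsilon2)
    fix e :: real assume "0 < e"
    then have "Liminf F (\<lambda>x. ereal (u x)) \<le> Liminf F (\<lambda>x. ereal (v x) + ereal e)"
      by (intro Liminf_mono ev)
    also have "\<dots> = Liminf F (\<lambda>x. ereal (v x)) + ereal e"
      by (rule Liminf_add_ereal_right[OF F]) simp
    finally show "Liminf F (\<lambda>x. ereal (u x)) \<le> Liminf F (\<lambda>x. ereal (v x)) + ereal e" .
  qed
qed

lemma Limsup_Liminf_eq_of_vanishing_diff:
  fixes u v r :: "'b \<Rightarrow> real"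
  assumes F: "F \<noteq> bot" and r: "(r \<longlongrightarrow> 0) F" and le: "eventually (\<lambda>x. \<bar>u x - v x\<bar> \<le> r x) F"
  shows "Limsup F (\<lambda>x. ereal (u x)) = Limsup F (\<lambda>x. ereal (v x))"
    and "Liminf F (\<lambda>x. ereal (u x)) = Liminf F (\<lambda>x. ereal (v x))"
proof -
  have 1: "eventually (\<lambda>x. u x \<le> v x + r x) F" and 2: "eventually (\<lambda>x. v x \<le> u x + r x) F"
    using le by (auto elim!: eventually_mono)
  show "Limsup F (\<lambda>x. ereal (u x)) = Limsup F (\<lambda>x. ereal (v x))"
    using Limsup_Liminf_le_of_vanishing_excess(1)[OF F r 1] Limsup_Liminf_le_of_vanishing_excess(1)[OF F r 2] by (rule antisym)
  show "Liminf F (\<lambda>x. ereal (u x)) = Liminf F (\<lambda>x. ereal (v x))"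
    using Limsup_Liminf_le_of_vanishing_excess(2)[OF F r 1] Limsup_Liminf_le_of_vanishing_excess(2)[OF F r 2] by (rule antisym)
qed

lemma Mink_dim_at_top:
  shows "upper_Mink_dim A = Limsup at_top (\<lambda>t. ereal (ln (real (covering_number A (1 / t))) / ln t))"
    and "lower_Mink_dim A = Liminf at_top (\<lambda>t. ereal (ln (real (covering_number A (1 / t))) / ln t))"
proof -
  have inj: "inj (inverse :: real \<Rightarrow> real)"
    by (rule injI) simp
  show "upper_Mink_dim A = Limsup at_top (\<lambda>t. ereal (ln (real (covering_number A (1 / t))) / ln t))"
    unfolding upper_Mink_dim_def at_right_to_top Limsup_filtermap_eq[OF inj] by (simp add: inverse_eq_divide)
  show "lower_Mink_dim A = Liminf at_top (\<lambda>t. ereal (ln (real (covering_number A (1 / t))) / ln t))"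
    unfolding lower_Mink_dim_def at_right_to_top Liminf_filtermap_eq[OF inj] by (simp add: inverse_eq_divide)
qed

text \<open>
  Multiplicative constants change the logarithm by a bounded amount, which division by \<open>ln t\<close> makes
  negligible.
\<close>

lemma Mag_dims_eq_Mink_dims_of_comparison:
  assumes pos: "0 < c" "0 < C"
    and N: "\<And>\<epsilon>. 0 < \<epsilon> \<Longrightarrow> 0 < covering_number A \<epsilon>"
    and mag: "\<And>t. t > 0 \<Longrightarrow> scaled_magnitude t A = ereal (m t)"
    and lower: "\<And>t. t > 0 \<Longrightarrow> c * real (covering_number A (1 / t)) \<le> m t"
    and upper: "\<And>t. t > 0 \<Longrightarrow> m t \<le> C * real (covering_number A (1 / t))"
  shows "upper_Mag_dim A = upper_Mink_dim A" and "lower_Mag_dim A = lower_Mink_dim A"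
proof -
  define n where "n t = real (covering_number A (1 / t))" for t
  define K where "K = \<bar>ln c\<bar> + \<bar>ln C\<bar>"
  have n: "0 < n t" if "t > 0" for t
    using N[of "1 / t"] that by (simp add: n_def)
  have m: "0 < m t" if "t > 0" for t
    using lower[OF that] mult_pos_pos[OF pos(1) n[OF that]] by (simp add: n_def)
  have r: "((\<lambda>t. K / ln t) \<longlongrightarrow> 0) at_top"
    by (rule real_tendsto_divide_at_top[OF tendsto_const ln_at_top])
  have close: "eventually (\<lambda>t. \<bar>ln (m t) / ln t - ln (n t) / ln t\<bar> \<le> K / ln t) at_top"
    using eventually_gt_at_top[of 1]
  proof eventually_elim
    fix t :: real assume t: "1 < t"
    then have t0: "t > 0"
      by simp
    have "ln c + ln (n t) \<le> ln (m t)"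
    proof -
      have "ln (c * n t) \<le> ln (m t)"
        using lower[OF t0] pos(1) n[OF t0] m[OF t0] by (intro ln_mono mult_pos_pos) (auto simp: n_def)
      then show ?thesis
        using pos(1) n[OF t0] by (simp add: ln_mult)
    qed
    moreover have "ln (m t) \<le> ln C + ln (n t)"
    proof -
      have "ln (m t) \<le> ln (C * n t)"
        using upper[OF t0] pos(2) n[OF t0] m[OF t0] by (intro ln_mono mult_pos_pos) (auto simp: n_def)
      then show ?thesis
        using pos(2) n[OF t0] by (simp add: ln_mult)
    qed
    ultimately have "\<bar>ln (m t) - ln (n t)\<bar> \<le> K"
      unfolding K_def by linarith
    then have "\<bar>ln (m t) - ln (n t)\<bar> / ln t \<le> K / ln t"
      using t by (intro divide_right_mono) auto
    moreover have "\<bar>ln (m t) / ln t - ln (n t) / ln t\<bar> = \<bar>ln (m t) - ln (n t)\<bar> / ln t"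
      using t by (simp add: diff_divide_distrib[symmetric] abs_divide)
    ultimately show "\<bar>ln (m t) / ln t - ln (n t) / ln t\<bar> \<le> K / ln t"
      by simp
  qed
  have eq: "eventually (\<lambda>t. ereal_ln (scaled_magnitude t A) / ereal (ln t) = ereal (ln (m t) / ln t)) at_top"
    using eventually_gt_at_top[of 1]
  proof eventually_elim
    fix t :: real assume t: "1 < t"
    then show "ereal_ln (scaled_magnitude t A) / ereal (ln t) = ereal (ln (m t) / ln t)"
      using mag[of t] m[of t] by (simp add: ereal_ln_def)
  qed
  note * = Limsup_Liminf_eq_of_vanishing_diff[OF trivial_limit_at_top_linorder r close]
  show "upper_Mag_dim A = upper_Mink_dim A"
    unfolding upper_Mag_dim_def Mink_dim_at_top n_def[symmetric] *(1)[symmetric] by (rule Limsup_eq[OF eq])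
  show "lower_Mag_dim A = lower_Mink_dim A"
    unfolding lower_Mag_dim_def Mink_dim_at_top n_def[symmetric] *(2)[symmetric] by (rule Liminf_eq[OF eq])
qed

section \<open>Magnitude is comparable to covering numbers\<close>

text \<open>
  The metric \<open>t |x - y|\<close> is the mean of \<open>|f x - f y|\<close>, where \<open>f x\<close> is the Gaussian projection to \<open>x\<close> divided by
  its normalising constant and multiplied by \<open>t\<close>. On a ball of radius \<open>1 / t\<close> the oscillation of \<open>f\<close> is at most
  \<open>2 / \<kappa>\<close> times the \<open>l\<^sup>1\<close> norm of the Gaussian vector, whose mean is \<open>\<kappa> n\<close>; hence the constant
  \<open>exp (2 n)\<close>.
\<close>

lemma euclidean_form_bounds:
  fixes \<mu> :: "'a::euclidean_space \<Rightarrow>\<^sub>0 complex"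
  assumes t: "t > 0"
  defines "Q \<equiv> Re (W_form (\<lambda>x y. t * dist x y) \<mu> \<mu>)"
  shows "0 \<le> Q"
    and "\<lbrakk>finite I; Poly_Mapping.keys \<mu> \<subseteq> (\<Union>x\<in>I. cball x (1 / t))\<rbrakk>
      \<Longrightarrow> (cmod (total_mass \<mu>))\<^sup>2 \<le> real (card I) * exp (2 * real DIM('a)) * Q"
proof -
  define F where "F = Poly_Mapping.keys \<mu>"
  define \<kappa> where "\<kappa> = sqrt (2 / pi)"
  have \<kappa>: "\<kappa> > 0"
    by (simp add: \<kappa>_def)
  define f where "f x = (\<lambda>\<omega>. t / \<kappa> * gaussian_proj x \<omega>)" for x :: 'a
  have F: "finite F"
    by (simp add: F_def)
  have f: "integrable gaussian_measure (f x)" for x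
    unfolding f_def using gaussian_proj_abs(1) by (rule integrable_mult_right)
  obtain w where w: "\<And>S. 0 \<le> w S"
    and w_dist: "\<And>a b. a \<in> F \<Longrightarrow> b \<in> F \<Longrightarrow>
      (LINT \<omega>|gaussian_measure. \<bar>f a \<omega> - f b \<omega>\<bar>) = (\<Sum>S\<in>Pow F. if separates S a b then w S else 0)"
    and w_cuts: "\<And>G g. \<lbrakk>G \<subseteq> F; integrable gaussian_measure g; \<And>\<omega>. 0 \<le> g \<omega>;
      \<And>a b \<omega>. a \<in> G \<Longrightarrow> b \<in> G \<Longrightarrow> \<bar>f a \<omega> - f b \<omega>\<bar> \<le> g \<omega>\<rbrakk>
      \<Longrightarrow> (\<Sum>S\<in>{S\<in>Pow F. cuts S G}. w S) \<le> (LINT \<omega>|gaussian_measure. g \<omega>)"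
    by (rule L1_metric_cut_decomposition[where M = gaussian_measure, OF F, of f]) (use f in blast)+
  have f_diff: "\<bar>f a \<omega> - f b \<omega>\<bar> = t / \<kappa> * \<bar>gaussian_proj (a - b) \<omega>\<bar>" for a b \<omega>
    unfolding f_def right_diff_distrib[symmetric] gaussian_proj_diff using t \<kappa> by (simp add: abs_mult)
  have d: "t * dist a b = (\<Sum>S\<in>Pow F. if separates S a b then w S else 0)" if "a \<in> F" "b \<in> F" for a b
  proof -
    have "(LINT \<omega>|gaussian_measure. \<bar>f a \<omega> - f b \<omega>\<bar>) = t / \<kappa> * (norm (a - b) * \<kappa>)"
      by (simp add: f_diff gaussian_proj_abs(2) \<kappa>_def)
    also have "\<dots> = t * dist a b"
      using \<kappa> by (simp add: dist_norm)
    finally show ?thesis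
      using w_dist[OF that] by simp
  qed
  have "finite (Pow F)"
    using F by simp
  note form = cut_metric_form[where d = "\<lambda>x y. t * dist x y" and u = "Poly_Mapping.lookup \<mu>",
      OF F this w d]
  have Q: "Q = Re (\<Sum>a\<in>F. \<Sum>b\<in>F. of_real (exp (- (t * dist a b))) * Poly_Mapping.lookup \<mu> a * cnj (Poly_Mapping.lookup \<mu> b))"
    by (simp add: Q_def W_form_def F_def)
  show "0 \<le> Q"
    unfolding Q by (rule form(1))
  assume I: "finite I" and cover: "Poly_Mapping.keys \<mu> \<subseteq> (\<Union>x\<in>I. cball x (1 / t))"
  have "(\<Sum>S\<in>{S\<in>Pow F. cuts S (F \<inter> cball x (1 / t))}. w S) \<le> 2 * real DIM('a)" for x
  proof -
    define g where "g = (\<lambda>\<omega>::'a \<Rightarrow> real. 2 / \<kappa> * (\<Sum>b\<in>Basis. \<bar>\<omega> b\<bar>))"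
    have "(\<Sum>S\<in>{S\<in>Pow F. cuts S (F \<inter> cball x (1 / t))}. w S) \<le> (LINT \<omega>|gaussian_measure. g \<omega>)"
    proof (rule w_cuts)
      show "integrable gaussian_measure g"
        unfolding g_def by (rule integrable_mult_right) (rule gaussian_l1(1))
      show "0 \<le> g \<omega>" for \<omega>
        using \<kappa> by (simp add: g_def sum_nonneg)
      show "\<bar>f a \<omega> - f b \<omega>\<bar> \<le> g \<omega>"
        if "a \<in> F \<inter> cball x (1 / t)" "b \<in> F \<inter> cball x (1 / t)" for a b \<omega>
      proof -
        have "norm (a - b) \<le> 2 / t"
          using that dist_triangle3[of a b x] by (simp add: dist_norm[symmetric])
        then have "norm (a - b) * (\<Sum>b\<in>Basis. \<bar>\<omega> b\<bar>) \<le> 2 / t * (\<Sum>b\<in>Basis. \<bar>\<omega> b\<bar>)"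
          by (intro mult_right_mono sum_nonneg) auto
        then have "\<bar>gaussian_proj (a - b) \<omega>\<bar> \<le> 2 / t * (\<Sum>b\<in>Basis. \<bar>\<omega> b\<bar>)"
          using gaussian_l1(3)[of "a - b" \<omega>] by linarith
        then have "t / \<kappa> * \<bar>gaussian_proj (a - b) \<omega>\<bar> \<le> t / \<kappa> * (2 / t * (\<Sum>b\<in>Basis. \<bar>\<omega> b\<bar>))"
          using t \<kappa> by (intro mult_left_mono) auto
        then show ?thesis
          unfolding f_diff g_def using t by simp
      qed
    qed auto
    also have "\<dots> = 2 * real DIM('a)"
      using \<kappa> unfolding g_def by (simp add: gaussian_l1(2) flip: \<kappa>_def)
    finally show ?thesis .
  qed
  note cut_mass = this
  show "(cmod (total_mass \<mu>))\<^sup>2 \<le> real (card I) * exp (2 * real DIM('a)) * Q"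
    unfolding Q total_mass_def F_def[symmetric]
    by (intro form(2)[where G = "\<lambda>x. cball x (1 / t)"] I cover[folded F_def] cut_mass)
qed

lemma psd_kernel_euclidean:
  assumes "t > 0"
  shows "psd_kernel (\<lambda>x y :: 'a::euclidean_space. t * dist x y)"
  using euclidean_form_bounds(1)[OF assms] by unfold_locales (simp_all add: dist_commute)

lemma scaled_magnitude_comparison:
  fixes A :: "'a::euclidean_space set"
  assumes A: "compact A" and t: "t > 0"
  obtains m where "scaled_magnitude t A = ereal m"
    "inverse (packing_const DIM('a)) * real (covering_number A (1 / t)) \<le> m"
    "m \<le> exp (2 * real DIM('a)) * real (covering_number A (1 / t))"
proof -
  let ?d = "\<lambda>x y :: 'a. t * dist x y"
  interpret psd_kernel ?d
    by (rule psd_kernel_euclidean[OF t])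
  have t': "1 / t > 0"
    using t by simp
  obtain I where I: "finite I" "card I = covering_number A (1 / t)" "A \<subseteq> (\<Union>x\<in>I. cball x (1 / t))"
    by (rule covering_number_attained[OF A t'])
  have upper: "(cmod (total_mass \<mu>))\<^sup>2 \<le>
      (exp (2 * real DIM('a)) * real (covering_number A (1 / t))) * (FM_norm ?d \<mu>)\<^sup>2" if "\<mu> \<in> FM A" for \<mu>
    using euclidean_form_bounds(2)[OF t I(1), of \<mu>] that I by (auto simp: FM_def seminorm_sq mult_ac)
  obtain m where m: "magnitude UNIV ?d A = ereal m" "0 \<le> m"
    "m \<le> exp (2 * real DIM('a)) * real (covering_number A (1 / t))"
    "\<And>\<nu>. \<nu> \<in> FM A \<Longrightarrow> (cmod (total_mass \<nu>))\<^sup>2 \<le> m * (FM_norm ?d \<nu>)\<^sup>2"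
    by (rule magnitude_variational[OF subset_UNIV _ upper]) auto
  obtain S where S: "finite S" "S \<subseteq> A" "separated (1 / t) S" "covering_number A (1 / t) \<le> card S"
    by (rule separated_net_exists[OF A t'])
  define \<nu> where "\<nu> = (\<Sum>b\<in>S. point_mass b)"
  have lookup: "Poly_Mapping.lookup \<nu> x = of_bool (x \<in> S)" for x
    unfolding \<nu>_def lookup_sum using S(1) by (simp add: lookup_single when_def sum.delta)
  have keys: "Poly_Mapping.keys \<nu> = S"
    by (auto simp: in_keys_iff lookup)
  have mass: "total_mass \<nu> = of_nat (card S)"
    by (simp add: total_mass_def keys lookup)
  have "(FM_norm ?d \<nu>)\<^sup>2 = (\<Sum>a\<in>S. \<Sum>b\<in>S. exp (- (dist a b / (1 / t))))"
    by (simp add: seminorm_sq W_form_def keys lookup mult.commute)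
  also have "\<dots> \<le> (\<Sum>a\<in>S. packing_const DIM('a))"
    by (intro sum_mono separated_exp_sum_le S t')
  finally have energy: "(FM_norm ?d \<nu>)\<^sup>2 \<le> real (card S) * packing_const DIM('a)"
    by simp
  have "(real (card S))\<^sup>2 \<le> m * (FM_norm ?d \<nu>)\<^sup>2"
    using m(4)[of \<nu>] S(2) by (simp add: FM_def keys mass)
  also have "\<dots> \<le> m * (real (card S) * packing_const DIM('a))"
    by (rule mult_left_mono[OF energy m(2)])
  finally have "real (card S) * real (card S) \<le> (m * packing_const DIM('a)) * real (card S)"
    by (simp add: power2_eq_square mult_ac)
  then have "real (card S) \<le> m * packing_const DIM('a)"
    using m(2) packing_const_pos[of "DIM('a)"] by (cases "card S = 0") (auto simp: mult_le_cancel_right)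
  then have "real (covering_number A (1 / t)) \<le> m * packing_const DIM('a)"
    using S(4) by linarith
  then have "inverse (packing_const DIM('a)) * real (covering_number A (1 / t)) \<le> m"
    using packing_const_pos[of "DIM('a)"] by (simp add: field_simps)
  with m(1,3) show ?thesis
    by (intro that[of m]) (simp_all add: scaled_magnitude_def)
qed

theorem magnitude_dims_eq_Minkowski_dims:
  fixes A :: "'a::euclidean_space set"
  assumes "compact A" "A \<noteq> {}"
  shows "upper_Mag_dim A = upper_Mink_dim A" and "lower_Mag_dim A = lower_Mink_dim A"
proof -
  define m where "m t = real_of_ereal (scaled_magnitude t A)" for t
  have m: "scaled_magnitude t A = ereal (m t)"
    "inverse (packing_const DIM('a)) * real (covering_number A (1 / t)) \<le> m t"
    "m t \<le> exp (2 * real DIM('a)) * real (covering_number A (1 / t))" if "t > 0" for t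
    by (rule scaled_magnitude_comparison[OF assms(1) that]; simp add: m_def)+
  note comparison = Mag_dims_eq_Mink_dims_of_comparison[OF _ _ covering_number_pos[OF assms] m]
  show "upper_Mag_dim A = upper_Mink_dim A" and "lower_Mag_dim A = lower_Mink_dim A"
    using packing_const_pos by (auto intro: comparison)
qed

theorem corollary7p4:
  fixes A :: "(real ^ 'n) set"
  assumes "compact A" and "A \<noteq> {}"
  shows "upper_Mag_dim A = upper_Mink_dim A \<and>
         lower_Mag_dim A = lower_Mink_dim A \<and>
         (Mag_dim_defined A \<longleftrightarrow> Mink_dim_defined A) \<and>
         (Mag_dim_defined A \<longrightarrow> Mag_dim A = Mink_dim A)"
  using magnitude_dims_eq_Minkowski_dims[OF assms]
  by (simp add: Mag_dim_defined_def Mink_dim_defined_def Mag_dim_def Mink_dim_def)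

end
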